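(* Let $n$ be a positive integer, $\alpha>1$, $M>0$ and $\rho\in(0,1/4)$. There exists a constant $C>0$, depending only on $n$, $M$, $\rho$ and $\alpha$, such that the following holds. Let $\Omega\subset\mathbb R^n$ be an open bounded set with $\partial\Omega\in C^\alpha_{M,\rho}$, and suppose that $B_r\subset\Omega\subset B_R$ with $1/2\le r\le R\le 2$. Let $e\in\mathbb S^{n-1}$, let $\pi_\lambda$ be the critical hyperplane of $\Omega$ with respect to $e$, suppose that $\operatorname{dist}(0,\pi_\lambda)\le 1/8$, and let $\Omega'$ be the reflection of $\Omega$ across $\pi_\lambda$. Then $$\Big|\big\{x\in\Omega\triangle\Omega' : \operatorname{dist}(x,\pi_\lambda)\le\gamma\big\}\Big|\le C\,\gamma\,(R-r)^{1-\frac1\alpha}\qquad\text{for all }0<\gamma\le 1/4.$$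
   Context: $B_r$ denotes the open ball of radius $r$ centred at the origin, $B^{n-1}_\rho$ the ball of radius $\rho$ centred at the origin in $\mathbb R^{n-1}$, and $|\cdot|$ of a set is Lebesgue measure. Critical hyperplane. For $\mu\in\mathbb R$ and $e\in\mathbb S^{n-1}$ let $\pi_\mu=\{x: x\cdot e=\mu\}$, and let $\Omega'_\mu$ be the reflection across $\pi_\mu$ of $\Omega\cap\{x\cdot e>\mu\}$. Let $\Lambda=\sup\{x\cdot e: x\in\Omega\}$ and $$\lambda=\inf\{\tilde\mu\in\mathbb R:\Omega'_\mu\subset\Omega\text{ for all }\mu\in(\tilde\mu,\Lambda)\}.$$ $\pi_\lambda$ is the critical hyperplane of $\Omega$ with respect to $e$. The class $C^\alpha_{M,\rho}$. For $\Omega$ with $C^1$ boundary and $x\in\partial\Omega$, let $\nu(x)$ be the unit outward normal and $\Pi_x(y)=(y-x)-((y-x)\cdot\nu(x))\nu(x)$, the (translated) projection onto the tangent plane $T_x\partial\Omega$, which is identified with $\mathbb R^{n-1}$. For an open set $\Omega$ with $C^\alpha$ boundary, we say $\partial\Omega\in C^\alpha_{M,\rho}$ if for all $x\in\partial\Omega$ there exists $\psi^{(x)}\in C^\alpha(B^{n-1}_\rho)$ with $\|\psi^{(x)}\|_{C^\alpha(B^{n-1}_\rho)}\le M$ and $B_\rho(x)\cap\Omega=\{y\in B_\rho(x): y\cdot\nu(x)<\psi^{(x)}(\Pi_x(y))\}$. Here $C^\alpha=C^{k,\beta}$ with $k=\lfloor\alpha\rfloor$, $\beta=\alpha-k$ if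 $\alpha\notin\mathbb Z$, and $C^\alpha=C^{\alpha-1,1}$ if $\alpha\in\mathbb Z$. *)

theory Defs
  imports "HOL-Analysis.Analysis"
begin

section \<open>Hoelder spaces on subsets of a linear subspace\<close>

text \<open>
  The space of dimension \<open>n - 1\<close> is represented by a hyperplane \<open>T\<close> through the origin of
  the ambient space, with the inherited Euclidean structure, and functions on it by functions
  on the ambient space of which only the values on \<open>T\<close> matter.  This also covers \<open>n = 1\<close>, where
  \<open>T = {0}\<close>.  Below, \<open>U\<close> is always a relatively open subset of the subspace \<open>T\<close>.
\<close>

definition dir_deriv :: "'a::euclidean_space \<Rightarrow> ('a \<Rightarrow> real) \<Rightarrow> 'a \<Rightarrow> real" where
  "dir_deriv v f z = deriv (\<lambda>t. f (z + t *\<^sub>R v)) 0"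

text \<open>\<open>iter_dir_deriv [v1, \<dots>, vj] f z\<close> is the value \<open>D\<^sup>j f(z)[v1, \<dots>, vj]\<close>.\<close>

primrec iter_dir_deriv :: "'a::euclidean_space list \<Rightarrow> ('a \<Rightarrow> real) \<Rightarrow> 'a \<Rightarrow> real" where
  "iter_dir_deriv [] f = f"
| "iter_dir_deriv (v # vs) f = dir_deriv v (iter_dir_deriv vs f)"

primrec Ck_on :: "nat \<Rightarrow> 'a::euclidean_space set \<Rightarrow> 'a set \<Rightarrow> ('a \<Rightarrow> real) \<Rightarrow> bool" where
  "Ck_on 0 T U f \<longleftrightarrow> continuous_on U f"
| "Ck_on (Suc k) T U f \<longleftrightarrow> continuous_on U f \<and>
     (\<forall>v\<in>T. (\<forall>z\<in>U. (\<lambda>t. f (z + t *\<^sub>R v)) differentiable (at 0)) \<and> Ck_on k T U (dir_deriv v f))"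

definition unit_lists :: "nat \<Rightarrow> 'a::euclidean_space set \<Rightarrow> 'a list set" where
  "unit_lists j T = {vs. length vs = j \<and> set vs \<subseteq> {v \<in> T. norm v = 1}}"

text \<open>The supremum over \<open>U\<close> of the norm of the \<open>j\<close>-linear form \<open>D\<^sup>j f(z)\<close> on \<open>T\<close>, and the
  \<open>\<beta>\<close>-Hoelder seminorm of \<open>D\<^sup>k f\<close>; both may be infinite.\<close>

definition deriv_sup :: "nat \<Rightarrow> 'a::euclidean_space set \<Rightarrow> 'a set \<Rightarrow> ('a \<Rightarrow> real) \<Rightarrow> ennreal" where
  "deriv_sup j T U f = (SUP z\<in>U. SUP vs\<in>unit_lists j T. ennreal \<bar>iter_dir_deriv vs f z\<bar>)"

definition holder_seminorm ::
    "nat \<Rightarrow> real \<Rightarrow> 'a::euclidean_space set \<Rightarrow> 'a set \<Rightarrow> ('a \<Rightarrow> real) \<Rightarrow> ennreal" where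
  "holder_seminorm k \<beta> T U f =
     (SUP (z, w)\<in>{(z, w). z \<in> U \<and> w \<in> U \<and> z \<noteq> w}. SUP vs\<in>unit_lists k T.
        ennreal (\<bar>iter_dir_deriv vs f z - iter_dir_deriv vs f w\<bar> / dist z w powr \<beta>))"

text \<open>\<open>C\<^sup>\<alpha> = C\<^bsup>k,\<beta>\<^esup>\<close> with \<open>(k, \<beta>) = (\<lfloor>\<alpha>\<rfloor>, \<alpha> - \<lfloor>\<alpha>\<rfloor>)\<close> for non-integral \<open>\<alpha>\<close>, and
  \<open>(k, \<beta>) = (\<alpha> - 1, 1)\<close> for integral \<open>\<alpha>\<close>.\<close>

definition holder_order :: "real \<Rightarrow> nat" where
  "holder_order \<alpha> = (if \<alpha> \<in> \<int> then nat (\<lfloor>\<alpha>\<rfloor> - 1) else nat \<lfloor>\<alpha>\<rfloor>)"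

definition holder_exponent :: "real \<Rightarrow> real" where
  "holder_exponent \<alpha> = (if \<alpha> \<in> \<int> then 1 else \<alpha> - of_int \<lfloor>\<alpha>\<rfloor>)"

definition holder_norm :: "real \<Rightarrow> 'a::euclidean_space set \<Rightarrow> 'a set \<Rightarrow> ('a \<Rightarrow> real) \<Rightarrow> ennreal" where
  "holder_norm \<alpha> T U f =
     (\<Sum>j\<le>holder_order \<alpha>. deriv_sup j T U f) +
     holder_seminorm (holder_order \<alpha>) (holder_exponent \<alpha>) T U f"

definition holder_on :: "real \<Rightarrow> 'a::euclidean_space set \<Rightarrow> 'a set \<Rightarrow> ('a \<Rightarrow> real) \<Rightarrow> bool" where
  "holder_on \<alpha> T U f \<longleftrightarrow> Ck_on (holder_order \<alpha>) T U f \<and> holder_norm \<alpha> T U f < \<infinity>"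


section \<open>Regularity of the boundary\<close>

definition orth_hyperplane :: "'a::euclidean_space \<Rightarrow> 'a set" where
  "orth_hyperplane w = {v. v \<bullet> w = 0}"

definition tangent_proj :: "'a::euclidean_space \<Rightarrow> 'a \<Rightarrow> 'a \<Rightarrow> 'a" where
  "tangent_proj w x y = (y - x) - ((y - x) \<bullet> w) *\<^sub>R w"

text \<open>Inside the ball of radius \<open>\<delta>\<close> about \<open>x\<close>, the set \<open>\<Omega>\<close> is the subgraph of \<open>\<psi>\<close> in the unit
  direction \<open>w\<close>.  The height \<open>y \<bullet> w\<close> is measured from the origin, not from \<open>x\<close>.\<close>

definition local_subgraph ::
    "'a::euclidean_space set \<Rightarrow> 'a \<Rightarrow> 'a \<Rightarrow> real \<Rightarrow> ('a \<Rightarrow> real) \<Rightarrow> bool" where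
  "local_subgraph \<Omega> x w \<delta> \<psi> \<longleftrightarrow>
     ball x \<delta> \<inter> \<Omega> = {y \<in> ball x \<delta>. y \<bullet> w < \<psi> (tangent_proj w x y)}"

definition holder_boundary :: "real \<Rightarrow> 'a::euclidean_space set \<Rightarrow> bool" where
  "holder_boundary \<alpha> \<Omega> \<longleftrightarrow>
     (\<forall>x\<in>frontier \<Omega>. \<exists>w \<delta> \<psi>. norm w = 1 \<and> \<delta> > 0 \<and>
        holder_on \<alpha> (orth_hyperplane w) (orth_hyperplane w \<inter> ball 0 \<delta>) \<psi> \<and>
        local_subgraph \<Omega> x w \<delta> \<psi>)"

text \<open>\<open>\<nu>\<close> is the unit outward normal at \<open>x\<close>: if \<open>\<Omega>\<close> is near \<open>x\<close> the subgraph of a \<open>C\<^sup>1\<close> function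
  \<open>\<psi>\<close> in direction \<open>w\<close>, and \<open>g\<close> is the gradient of \<open>\<psi>\<close> at the base point, then the outward
  normal direction is \<open>w - g\<close>.  It does not depend on the chosen representation.\<close>

definition outward_unit_normal :: "'a::euclidean_space set \<Rightarrow> 'a \<Rightarrow> 'a \<Rightarrow> bool" where
  "outward_unit_normal \<Omega> x \<nu> \<longleftrightarrow>
     (\<exists>w \<delta> \<psi> g. norm w = 1 \<and> \<delta> > 0 \<and>
        Ck_on 1 (orth_hyperplane w) (orth_hyperplane w \<inter> ball 0 \<delta>) \<psi> \<and>
        local_subgraph \<Omega> x w \<delta> \<psi> \<and>
        g \<in> orth_hyperplane w \<and>
        (\<psi> has_derivative (\<lambda>v. g \<bullet> v)) (at 0 within orth_hyperplane w) \<and>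
        \<nu> = (w - g) /\<^sub>R norm (w - g))"

definition boundary_class :: "real \<Rightarrow> real \<Rightarrow> real \<Rightarrow> 'a::euclidean_space set \<Rightarrow> bool" where
  "boundary_class \<alpha> M \<rho> \<Omega> \<longleftrightarrow> open \<Omega> \<and> holder_boundary \<alpha> \<Omega> \<and>
     (\<forall>x\<in>frontier \<Omega>. \<exists>\<nu>. outward_unit_normal \<Omega> x \<nu> \<and>
        (\<exists>\<psi>. holder_on \<alpha> (orth_hyperplane \<nu>) (orth_hyperplane \<nu> \<inter> ball 0 \<rho>) \<psi> \<and>
             holder_norm \<alpha> (orth_hyperplane \<nu>) (orth_hyperplane \<nu> \<inter> ball 0 \<rho>) \<psi> \<le> ennreal M \<and>
             local_subgraph \<Omega> x \<nu> \<rho> \<psi>))"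


section \<open>Critical hyperplane\<close>

definition hyperplane_at :: "'a::euclidean_space \<Rightarrow> real \<Rightarrow> 'a set" where
  "hyperplane_at e \<mu> = {x. x \<bullet> e = \<mu>}"

text \<open>Reflection across \<open>hyperplane_at e \<mu>\<close>, for a unit vector \<open>e\<close>.\<close>

definition reflection :: "'a::euclidean_space \<Rightarrow> real \<Rightarrow> 'a \<Rightarrow> 'a" where
  "reflection e \<mu> x = x - (2 * (x \<bullet> e - \<mu>)) *\<^sub>R e"

definition reflected_cap :: "'a::euclidean_space set \<Rightarrow> 'a \<Rightarrow> real \<Rightarrow> 'a set" where
  "reflected_cap \<Omega> e \<mu> = reflection e \<mu> ` (\<Omega> \<inter> {x. x \<bullet> e > \<mu>})"

definition critical_value :: "'a::euclidean_space set \<Rightarrow> 'a \<Rightarrow> real" where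
  "critical_value \<Omega> e =
     Inf {m. \<forall>\<mu>\<in>{m<..<Sup ((\<lambda>x. x \<bullet> e) ` \<Omega>)}. reflected_cap \<Omega> e \<mu> \<subseteq> \<Omega>}"

end

theory Submission
  imports Defs
begin

text \<open>
  Put \<open>\<delta> = R - r\<close>, \<open>\<eta> = \<delta> powr (1 - 1/\<alpha>)\<close>, and let \<open>\<mu>\<close> be the critical value.  If \<open>x'\<close> is the reflection
  of \<open>x\<close>, then \<open>norm x ^ 2 - norm x' ^ 2 = 4 * \<mu> * s\<close>, where \<open>s\<close> is the signed distance of \<open>x\<close> to the
  hyperplane.  When exactly one of the two points lies in \<open>\<Omega>\<close>, this puts \<open>x\<close> into a shell on which
  \<open>norm x ^ 2\<close> varies by \<open>O(\<delta> + \<bar>\<mu>\<bar>)\<close> only, and this shell meets the slab of width \<open>2 * \<gamma>\<close> in a set of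
  measure \<open>O(\<gamma> * (\<delta> + \<bar>\<mu>\<bar>))\<close>.

  It remains to see that \<open>\<bar>\<mu>\<bar> = O(\<eta>)\<close>.  Reflecting the top of \<open>B\<^sub>r\<close> gives \<open>- \<delta> / 2 \<le> \<mu>\<close>.  Conversely, suppose
  that \<open>x \<in> \<Omega>\<close> and \<open>x' \<notin> \<Omega>\<close> for a hyperplane of height \<open>\<mu>\<close>.  Then \<open>s \<le> \<delta> / \<mu>\<close>, so both points lie
  in one graph chart.  The squared norm of the graph points over the segment from \<open>x'\<close> to \<open>x\<close> increases
  by at least \<open>4 * \<mu> * s\<close>.  But it stays within \<open>O(\<delta>)\<close> of \<open>r ^ 2\<close> and is of class \<open>C\<^sup>\<alpha>\<close>, so by interpolation
  its derivative is \<open>O(\<eta>)\<close> and its increase is \<open>O(\<eta> * s)\<close>.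
\<close>

section \<open>Interpolation along lines\<close>

text \<open>All norms on polynomials of degree at most \<open>d\<close> are equivalent. The
  induction makes this elementary: the lower coefficients of \<open>P\<close> survive in the
  polynomial \<open>Q\<close> of smaller degree, with factors of modulus at least 1.\<close>

lemma poly_coeff_bound:
  "\<exists>C\<ge>0. \<forall>(P :: real poly) \<epsilon>. degree P \<le> d \<and> (\<forall>t\<in>{0..1}. \<bar>poly P t\<bar> \<le> \<epsilon>) \<longrightarrow>
     (\<forall>j. \<bar>coeff P j\<bar> \<le> C * \<epsilon>)"
proof (induction d)
  case 0
  have "\<bar>coeff P j\<bar> \<le> 1 * \<epsilon>" if "degree P \<le> 0" "\<forall>t\<in>{0..1}. \<bar>poly P t\<bar> \<le> \<epsilon>" for P :: "real poly" and \<epsilon> j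
  proof -
    obtain a where P: "P = [:a:]" using \<open>degree P \<le> 0\<close> degree_eq_zeroE by blast
    have "\<bar>a\<bar> \<le> \<epsilon>" using that(2)[rule_format, of 0] by (simp add: P)
    then show ?thesis by (cases j) (auto simp: P)
  qed
  then show ?case by (intro exI[of _ 1]) auto
next
  case (Suc d)
  then obtain C where "C \<ge> 0" and C: "\<And>(P :: real poly) \<epsilon> j. degree P \<le> d \<Longrightarrow>
      (\<forall>t\<in>{0..1}. \<bar>poly P t\<bar> \<le> \<epsilon>) \<Longrightarrow> \<bar>coeff P j\<bar> \<le> C * \<epsilon>" by blast
  define C' where "C' = C * (1 + 2 ^ Suc d)"
  have "C' \<ge> 0" using \<open>C \<ge> 0\<close> by (simp add: C'_def)
  define K where "K = 1 + C' * real (Suc d) + C'"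
  have "\<bar>coeff P j\<bar> \<le> K * \<epsilon>"
    if deg: "degree P \<le> Suc d" and bd: "\<forall>t\<in>{0..1}. \<bar>poly P t\<bar> \<le> \<epsilon>" for P :: "real poly" and \<epsilon> j
  proof -
    have "\<epsilon> \<ge> 0" using bd[rule_format, of 0] by auto
    \<comment> \<open>comparing \<open>P\<close> with its dilate by \<open>1/2\<close> kills the top coefficient\<close>
    define Q where "Q = P - smult (2 ^ Suc d) (P \<circ>\<^sub>p [:0, 1/2:])"
    have cQ: "coeff Q i = coeff P i * (1 - 2 ^ Suc d * (1/2) ^ i)" for i
      by (simp add: Q_def coeff_pcompose_linear algebra_simps)
    have "degree Q \<le> d"
    proof (rule degree_le, intro allI impI)
      fix i assume "d < i"
      show "coeff Q i = 0"
      proof (cases "i = Suc d")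
        case True
        then show ?thesis by (simp add: cQ power_one_over)
      next
        case False
        then have "degree P < i" using deg \<open>d < i\<close> by simp
        then show ?thesis by (simp add: cQ coeff_eq_0)
      qed
    qed
    moreover have "\<bar>poly Q t\<bar> \<le> (1 + 2 ^ Suc d) * \<epsilon>" if "t \<in> {0..1}" for t
    proof -
      have "\<bar>poly P t\<bar> \<le> \<epsilon>" "\<bar>poly P (t * (1/2))\<bar> \<le> \<epsilon>" using bd that by auto
      then have "\<bar>poly P t\<bar> + 2 ^ Suc d * \<bar>poly P (t * (1/2))\<bar> \<le> \<epsilon> + 2 ^ Suc d * \<epsilon>"
        by (intro add_mono mult_left_mono) auto
      moreover have "\<bar>poly Q t\<bar> \<le> \<bar>poly P t\<bar> + 2 ^ Suc d * \<bar>poly P (t * (1/2))\<bar>"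
        unfolding Q_def poly_diff poly_smult poly_pcompose
        by (rule order_trans[OF abs_triangle_ineq4]) (simp add: abs_mult)
      ultimately show ?thesis by (simp add: algebra_simps)
    qed
    ultimately have Qb: "\<bar>coeff Q i\<bar> \<le> C' * \<epsilon>" for i
      using C[of Q "(1 + 2 ^ Suc d) * \<epsilon>" i] by (simp add: C'_def mult.assoc)
    have low: "\<bar>coeff P i\<bar> \<le> C' * \<epsilon>" if "i \<le> d" for i
    proof -
      have "(2::real) ^ Suc d * (1/2) ^ i = 2 ^ (Suc d - i)"
        using that by (simp add: power_diff power_one_over field_simps)
      moreover have "(2::real) ^ 1 \<le> 2 ^ (Suc d - i)"
        using that by (intro power_increasing) auto
      ultimately have "1 \<le> \<bar>1 - (2::real) ^ Suc d * (1/2) ^ i\<bar>" by simp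
      then have "\<bar>coeff P i\<bar> * 1 \<le> \<bar>coeff P i\<bar> * \<bar>1 - (2::real) ^ Suc d * (1/2) ^ i\<bar>"
        by (intro mult_left_mono) auto
      also have "\<dots> = \<bar>coeff Q i\<bar>" by (simp add: cQ abs_mult)
      finally show ?thesis using Qb[of i] by simp
    qed
    \<comment> \<open>The top coefficient, lost in \<open>Q\<close>, is recovered from the value at
      1.\<close>
    have "poly P 1 = (\<Sum>i\<le>Suc d. coeff P i)"
      unfolding poly_altdef using deg by (intro sum.mono_neutral_cong_left) (auto simp: coeff_eq_0)
    then have "coeff P (Suc d) = poly P 1 - (\<Sum>i\<le>d. coeff P i)" by simp
    moreover have "\<bar>\<Sum>i\<le>d. coeff P i\<bar> \<le> (\<Sum>i\<le>d. C' * \<epsilon>)"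
      using low by (intro order_trans[OF sum_abs] sum_mono) auto
    moreover have "\<bar>poly P 1\<bar> \<le> \<epsilon>" using bd by auto
    ultimately have top: "\<bar>coeff P (Suc d)\<bar> \<le> \<epsilon> + real (Suc d) * (C' * \<epsilon>)" by simp
    have "0 \<le> C' * \<epsilon>" using \<open>C' \<ge> 0\<close> \<open>\<epsilon> \<ge> 0\<close> by simp
    then have K: "C' * \<epsilon> \<le> K * \<epsilon>" "\<epsilon> + real (Suc d) * (C' * \<epsilon>) \<le> K * \<epsilon>"
      using \<open>\<epsilon> \<ge> 0\<close> mult_nonneg_nonneg[of "real d" "C' * \<epsilon>"] by (simp_all add: K_def algebra_simps)
    consider "j \<le> d" | "j = Suc d" | "j > Suc d" by linarith
    then show ?thesis
    proof cases
      case 3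
      then have "coeff P j = 0" using deg by (simp add: coeff_eq_0)
      then show ?thesis using K(1) \<open>0 \<le> C' * \<epsilon>\<close> by simp
    qed (use low top K in fastforce)+
  qed
  moreover have "K \<ge> 0" using \<open>C' \<ge> 0\<close> by (simp add: K_def)
  ultimately show ?case by blast
qed

text \<open>Rescaling \<open>[0, \<tau>]\<close> to the unit interval multiplies the linear
  coefficient by \<tau>. With \<epsilon> of order \<delta> and \<tau> =
  \<open>\<delta> powr (1/\<alpha>)\<close>, the ratio \<epsilon> / \<tau> is the source of the
  exponent 1 - 1/\<alpha>.\<close>

lemma poly_linear_coeff_bound:
  "\<exists>C\<ge>0. \<forall>(P :: real poly) \<epsilon> \<tau>. degree P \<le> d \<and> 0 < \<tau> \<and> (\<forall>t\<in>{0..\<tau>}. \<bar>poly P t\<bar> \<le> \<epsilon>) \<longrightarrow>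
     \<bar>coeff P 1\<bar> * \<tau> \<le> C * \<epsilon>"
proof -
  obtain C where "C \<ge> 0" and C: "\<And>(P :: real poly) \<epsilon> j. degree P \<le> d \<Longrightarrow>
      (\<forall>t\<in>{0..1}. \<bar>poly P t\<bar> \<le> \<epsilon>) \<Longrightarrow> \<bar>coeff P j\<bar> \<le> C * \<epsilon>"
    using poly_coeff_bound[of d] by blast
  have "\<bar>coeff P 1\<bar> * \<tau> \<le> C * \<epsilon>"
    if "degree P \<le> d" "0 < \<tau>" "\<forall>t\<in>{0..\<tau>}. \<bar>poly P t\<bar> \<le> \<epsilon>" for P :: "real poly" and \<epsilon> \<tau>
  proof -
    have "\<bar>coeff (P \<circ>\<^sub>p [:0, \<tau>:]) 1\<bar> \<le> C * \<epsilon>"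
    proof (rule C)
      show "degree (P \<circ>\<^sub>p [:0, \<tau>:]) \<le> d" using that by (simp add: degree_pcompose)
      show "\<forall>t\<in>{0..1}. \<bar>poly (P \<circ>\<^sub>p [:0, \<tau>:]) t\<bar> \<le> \<epsilon>"
        using that by (auto simp: poly_pcompose mult_left_le_one_le)
    qed
    then show ?thesis using \<open>0 < \<tau>\<close> by (simp add: coeff_pcompose_linear abs_mult mult.commute)
  qed
  with \<open>C \<ge> 0\<close> show ?thesis by blast
qed

section \<open>Hoelder functions along lines\<close>

lemma iter_dir_deriv_bound:
  assumes "holder_norm \<alpha> T U f \<le> ennreal M" "0 \<le> M" "vs \<in> unit_lists j T" "j \<le> holder_order \<alpha>" "z \<in> U"
  shows "\<bar>iter_dir_deriv vs f z\<bar> \<le> M"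
proof -
  have "ennreal \<bar>iter_dir_deriv vs f z\<bar> \<le> deriv_sup j T U f"
    unfolding deriv_sup_def using assms(3,5) by (intro SUP_upper2[of z] SUP_upper) auto
  also have "\<dots> \<le> (\<Sum>j\<le>holder_order \<alpha>. deriv_sup j T U f)"
    using assms(4) by (intro sum_nonneg_leq_bound[OF _ _ refl]) auto
  also have "\<dots> \<le> holder_norm \<alpha> T U f" unfolding holder_norm_def by simp
  also note assms(1)
  finally show ?thesis using \<open>0 \<le> M\<close> by simp
qed

lemma iter_dir_deriv_holder:
  assumes "holder_norm \<alpha> T U f \<le> ennreal M" "0 \<le> M" "vs \<in> unit_lists (holder_order \<alpha>) T" "z \<in> U" "y \<in> U"
  shows "\<bar>iter_dir_deriv vs f z - iter_dir_deriv vs f y\<bar> \<le> M * dist z y powr holder_exponent \<alpha>"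
proof (cases "z = y")
  case False
  have "ennreal (\<bar>iter_dir_deriv vs f z - iter_dir_deriv vs f y\<bar> / dist z y powr holder_exponent \<alpha>)
      \<le> holder_seminorm (holder_order \<alpha>) (holder_exponent \<alpha>) T U f"
    unfolding holder_seminorm_def using assms(3-5) False
    by (intro SUP_upper2[of "(z, y)"]) (auto intro!: SUP_upper)
  also have "\<dots> \<le> holder_norm \<alpha> T U f" unfolding holder_norm_def by simp
  also note assms(1)
  finally show ?thesis using \<open>0 \<le> M\<close> False by (simp add: divide_le_eq)
qed (use assms in simp)

lemma Ck_on_continuous: "Ck_on k T U f \<Longrightarrow> continuous_on U f"
  by (cases k) auto

lemma Ck_on_iter_dir_deriv:
  assumes "u \<in> T"
  shows "Ck_on (m + j) T U f \<Longrightarrow> Ck_on m T U (iter_dir_deriv (replicate j u) f)"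
proof (induction j arbitrary: m)
  case (Suc j)
  have "Ck_on (Suc m) T U (iter_dir_deriv (replicate j u) f)"
    using Suc.IH[of "Suc m"] Suc.prems by (simp only: add_Suc add_Suc_right)
  with \<open>u \<in> T\<close> show ?case by simp
qed simp

text \<open>\<open>dir_deriv\<close> differentiates only at parameter 0 of a line, so the base point
  is moved to \<open>z + t *\<^sub>R u\<close> and the derivative is then shifted back to
  \<open>t\<close>.\<close>

lemma iter_dir_deriv_line:
  assumes "Ck_on k T U f" "j < k" "u \<in> T" "z + t *\<^sub>R u \<in> U"
  shows "((\<lambda>t. iter_dir_deriv (replicate j u) f (z + t *\<^sub>R u)) has_real_derivative
     iter_dir_deriv (replicate (Suc j) u) f (z + t *\<^sub>R u)) (at t)"
proof -
  let ?F = "iter_dir_deriv (replicate j u) f"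
  have "Ck_on (Suc (k - Suc j)) T U ?F"
    using assms by (intro Ck_on_iter_dir_deriv) auto
  then have "(\<lambda>s. ?F (z + t *\<^sub>R u + s *\<^sub>R u)) differentiable (at 0)"
    using assms by simp
  then have "((\<lambda>s. ?F (z + t *\<^sub>R u + s *\<^sub>R u)) has_real_derivative dir_deriv u ?F (z + t *\<^sub>R u)) (at 0)"
    by (simp add: dir_deriv_def DERIV_deriv_iff_real_differentiable)
  then have "((\<lambda>s. ?F (z + (s + t) *\<^sub>R u)) has_real_derivative dir_deriv u ?F (z + t *\<^sub>R u)) (at 0)"
    by (simp add: scaleR_left_distrib add.assoc add.commute[of "t *\<^sub>R u"])
  then show ?thesis
    using DERIV_shift[of "\<lambda>s. ?F (z + s *\<^sub>R u)" "dir_deriv u ?F (z + t *\<^sub>R u)" 0 t] by simp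
qed

lemma holder_order_ge_1: "\<alpha> > 1 \<Longrightarrow> holder_order \<alpha> \<ge> 1"
  unfolding holder_order_def by (auto elim!: Ints_cases simp: le_nat_iff le_floor_iff)

lemma holder_order_exponent: "\<alpha> > 1 \<Longrightarrow> real (holder_order \<alpha>) + holder_exponent \<alpha> = \<alpha>"
  unfolding holder_order_def holder_exponent_def by (auto elim!: Ints_cases)

lemma holder_exponent_pos: "\<alpha> > 1 \<Longrightarrow> holder_exponent \<alpha> > 0"
  unfolding holder_exponent_def
  by (metis Ints_of_int diff_gt_0_iff_gt of_int_floor_le order_less_le zero_less_one)

text \<open>On the line in direction \<open>u\<close>, Maclaurin's formula puts the derivative of
  order \<open>k\<close> at an intermediate point. Replacing it by its value at 0 costs at most
  \<open>M * t powr holder_exponent \<alpha>\<close>, and the factor \<open>t ^ k\<close> raises the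
  exponent to \<alpha>.\<close>

lemma holder_taylor:
  fixes f :: "'a::euclidean_space \<Rightarrow> real"
  assumes "\<alpha> > 1" "0 \<le> M" and ho: "holder_on \<alpha> T U f" and bd: "holder_norm \<alpha> T U f \<le> ennreal M"
    and u: "u \<in> T" "norm u = 1" and seg: "\<And>t. t \<in> {0..\<tau>} \<Longrightarrow> z + t *\<^sub>R u \<in> U" and z: "z \<in> U"
  shows "\<exists>P. degree P \<le> holder_order \<alpha> \<and> coeff P 0 = f z \<and> coeff P 1 = dir_deriv u f z \<and>
     (\<forall>t\<in>{0..\<tau>}. \<bar>f (z + t *\<^sub>R u) - poly P t\<bar> \<le> M * t powr \<alpha>)"
proof -
  define k where "k = holder_order \<alpha>"
  have "k \<ge> 1" unfolding k_def using holder_order_ge_1 \<open>\<alpha> > 1\<close> .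
  define D where "D j t = iter_dir_deriv (replicate j u) f (z + t *\<^sub>R u)" for j t
  define P where "P = (\<Sum>j\<le>k. monom (D j 0 / fact j) j)"
  have c: "coeff P i = (if i \<le> k then D i 0 / fact i else 0)" for i
    unfolding P_def coeff_sum coeff_monom by simp
  have pP: "poly P t = (\<Sum>j\<le>k. D j 0 / fact j * t ^ j)" for t
    unfolding P_def poly_sum poly_monom by simp
  have ck: "Ck_on k T U f" using ho by (simp add: holder_on_def k_def)
  have "degree P \<le> k" by (rule degree_le) (simp add: c)
  moreover have "coeff P 0 = f z" "coeff P 1 = dir_deriv u f z"
    using \<open>k \<ge> 1\<close> by (simp_all add: c D_def)
  moreover have "\<bar>f (z + t *\<^sub>R u) - poly P t\<bar> \<le> M * t powr \<alpha>" if t: "t \<in> {0..\<tau>}" for t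
  proof (cases "t = 0")
    case True
    have "poly P 0 = f z" by (simp add: poly_0_coeff_0 c D_def)
    with True show ?thesis by simp
  next
    case False
    with t have "0 < t" by simp
    have "\<exists>s. 0 < s \<and> s < t \<and> D 0 t = (\<Sum>m<k. D m 0 / fact m * t ^ m) + D k s / fact k * t ^ k"
    proof (rule Maclaurin[where diff = D])
      show "\<forall>m s. m < k \<and> 0 \<le> s \<and> s \<le> t \<longrightarrow> (D m has_real_derivative D (Suc m) s) (at s)"
        unfolding D_def using t seg ck u(1) by (intro allI impI iter_dir_deriv_line) auto
    qed (use \<open>0 < t\<close> \<open>k \<ge> 1\<close> in auto)
    then obtain s where s: "0 < s" "s < t"
      and eq: "D 0 t = (\<Sum>m<k. D m 0 / fact m * t ^ m) + D k s / fact k * t ^ k" by blast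
    have "f (z + t *\<^sub>R u) - poly P t = (D k s - D k 0) * (t ^ k / fact k)"
      using eq by (simp add: pP D_def lessThan_Suc_atMost[symmetric] field_simps)
    then have "\<bar>f (z + t *\<^sub>R u) - poly P t\<bar> = \<bar>D k s - D k 0\<bar> * (t ^ k / fact k)"
      using \<open>0 < t\<close> by (simp add: abs_mult)
    also have "\<dots> \<le> (M * t powr holder_exponent \<alpha>) * (t ^ k / 1)"
    proof (intro mult_mono divide_left_mono)
      have "\<bar>D k s - D k 0\<bar> \<le> M * dist (z + s *\<^sub>R u) (z + 0 *\<^sub>R u) powr holder_exponent \<alpha>"
        unfolding D_def
        by (rule iter_dir_deriv_holder[OF bd \<open>0 \<le> M\<close>])
          (use s t seg z u in \<open>auto simp: unit_lists_def k_def\<close>)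
      also have "\<dots> \<le> M * t powr holder_exponent \<alpha>"
        using s u \<open>0 \<le> M\<close> holder_exponent_pos[OF \<open>\<alpha> > 1\<close>]
        by (intro mult_left_mono powr_mono2) (auto simp: dist_norm)
      finally show "\<bar>D k s - D k 0\<bar> \<le> M * t powr holder_exponent \<alpha>" .
    qed (use \<open>0 < t\<close> \<open>0 \<le> M\<close> in \<open>auto simp: fact_ge_1\<close>)
    also have "\<dots> = M * t powr (holder_exponent \<alpha> + real k)"
      using \<open>0 < t\<close> by (simp add: powr_add powr_realpow)
    finally show ?thesis using holder_order_exponent[OF \<open>\<alpha> > 1\<close>] by (simp add: k_def add.commute)
  qed
  ultimately show ?thesis unfolding k_def by blast
qed

text \<open>Mean value theorem on the segment from \<open>y\<close> to \<open>z\<close>: as \<alpha>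
  > 1, the Hoelder norm bounds the first derivatives.\<close>

lemma holder_lipschitz:
  fixes f :: "'a::euclidean_space \<Rightarrow> real"
  assumes "\<alpha> > 1" "0 \<le> M" and ho: "holder_on \<alpha> T U f" and bd: "holder_norm \<alpha> T U f \<le> ennreal M"
    and T: "subspace T" and U: "convex U" and zy: "z \<in> U" "y \<in> U" "z - y \<in> T"
  shows "\<bar>f z - f y\<bar> \<le> M * norm (z - y)"
proof (cases "z = y")
  case False
  define l where "l = norm (z - y)"
  define u where "u = (z - y) /\<^sub>R l"
  have l: "l > 0" using False by (simp add: l_def)
  have u: "u \<in> T" "norm u = 1" "y + l *\<^sub>R u = z"
    using l T zy by (auto simp: u_def subspace_scale) (simp add: l_def)
  have seg: "y + t *\<^sub>R u \<in> U" if "t \<in> {0..l}" for t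
  proof -
    have "y + t *\<^sub>R u = (1 - t / l) *\<^sub>R y + (t / l) *\<^sub>R z"
      using l by (simp add: u_def algebra_simps divide_inverse)
    then show ?thesis using U zy l that by (simp add: convexD_alt)
  qed
  have k: "holder_order \<alpha> \<ge> 1" using holder_order_ge_1 \<open>\<alpha> > 1\<close> .
  have "((\<lambda>t. f (y + t *\<^sub>R u)) has_real_derivative iter_dir_deriv [u] f (y + t *\<^sub>R u)) (at t)"
    if "t \<in> {0..l}" for t
    using iter_dir_deriv_line[of "holder_order \<alpha>" T U f 0 u y t] ho k u seg[OF that]
    by (simp add: holder_on_def)
  then have "\<exists>t>0. t < l \<and> f (y + l *\<^sub>R u) - f (y + 0 *\<^sub>R u) = (l - 0) * iter_dir_deriv [u] f (y + t *\<^sub>R u)"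
    using l by (intro MVT2) auto
  then obtain t where t: "0 < t" "t < l" "f z - f y = l * iter_dir_deriv [u] f (y + t *\<^sub>R u)"
    using u by auto
  have "\<bar>iter_dir_deriv [u] f (y + t *\<^sub>R u)\<bar> \<le> M"
    using iter_dir_deriv_bound[OF bd \<open>0 \<le> M\<close>, of "[u]" 1] u k seg t by (auto simp: unit_lists_def)
  then show ?thesis using t l by (simp add: abs_mult l_def mult.commute mult_left_mono)
qed simp

text \<open>Below, \<open>norm (q + t u)\<^sup>2 + f (z + t u)\<^sup>2\<close> is the squared norm of a point of the graph of \<open>f\<close>.
  On a segment of length \<open>\<delta> powr (1/\<alpha>)\<close> it agrees with a polynomial up to \<open>O(\<delta>)\<close>, so if it also
  oscillates by \<open>O(\<delta>)\<close> there, the linear coefficient is \<open>O(\<delta> / \<delta> powr (1/\<alpha>))\<close>.\<close>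

lemma dir_deriv_almost_radial:
  fixes \<alpha> M :: real
  assumes "\<alpha> > 1" "M > 0"
  shows "\<exists>C\<ge>1. \<forall>(T :: 'a::euclidean_space set) U f u z q a \<delta>.
    holder_on \<alpha> T U f \<and> holder_norm \<alpha> T U f \<le> ennreal M \<and> u \<in> T \<and> norm u = 1 \<and> z \<in> U \<and>
    0 < \<delta> \<and> \<delta> powr (1/\<alpha>) \<le> 1 \<and>
    (\<forall>t\<in>{0..\<delta> powr (1/\<alpha>)}. z + t *\<^sub>R u \<in> U \<and>
       \<bar>(norm (q + t *\<^sub>R u))\<^sup>2 + (f (z + t *\<^sub>R u))\<^sup>2 - a\<bar> \<le> 4 * \<delta>) \<longrightarrow>
    \<bar>2 * (q \<bullet> u) + 2 * f z * dir_deriv u f z\<bar> \<le> C * \<delta> powr (1 - 1/\<alpha>)"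
proof -
  define k where "k = holder_order \<alpha>"
  have "k \<ge> 1" unfolding k_def using holder_order_ge_1 \<open>\<alpha> > 1\<close> .
  obtain C where "C \<ge> 0" and C: "\<And>(P :: real poly) \<epsilon> \<tau>. degree P \<le> 2 * k \<Longrightarrow> 0 < \<tau> \<Longrightarrow>
      (\<forall>t\<in>{0..\<tau>}. \<bar>poly P t\<bar> \<le> \<epsilon>) \<Longrightarrow> \<bar>coeff P 1\<bar> * \<tau> \<le> C * \<epsilon>"
    using poly_linear_coeff_bound[of "2 * k"] by blast
  \<comment> \<open>The 4 is the assumed oscillation. The rest is the error of replacing
    \<open>f\<close> by its Taylor polynomial in the square: the difference of the two is at most
    \<open>M * \<delta>\<close>, their sum at most \<open>3 * M\<close>.\<close>
  define K where "K = max 1 (C * (4 + 3 * M\<^sup>2))"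
  have "\<bar>2 * (q \<bullet> u) + 2 * f z * dir_deriv u f z\<bar> \<le> K * \<delta> powr (1 - 1/\<alpha>)"
    if ho: "holder_on \<alpha> T U f" and bd: "holder_norm \<alpha> T U f \<le> ennreal M"
      and u: "u \<in> T" "norm u = 1" and z: "z \<in> U"
      and \<delta>: "0 < \<delta>" "\<delta> powr (1/\<alpha>) \<le> 1"
      and seg: "\<And>t. t \<in> {0..\<delta> powr (1/\<alpha>)} \<Longrightarrow> z + t *\<^sub>R u \<in> U"
      and osc: "\<And>t. t \<in> {0..\<delta> powr (1/\<alpha>)} \<Longrightarrow>
         \<bar>(norm (q + t *\<^sub>R u))\<^sup>2 + (f (z + t *\<^sub>R u))\<^sup>2 - a\<bar> \<le> 4 * \<delta>"
    for T U :: "'a set" and f u z q a \<delta>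
  proof -
    define \<tau> where "\<tau> = \<delta> powr (1/\<alpha>)"
    have \<tau>: "0 < \<tau>" "\<tau> \<le> 1" "\<tau> powr \<alpha> = \<delta>"
      using \<delta> \<open>\<alpha> > 1\<close> by (simp_all add: \<tau>_def powr_powr)
    obtain P where P: "degree P \<le> k" "coeff P 0 = f z" "coeff P 1 = dir_deriv u f z"
      and tay: "\<And>t. t \<in> {0..\<tau>} \<Longrightarrow> \<bar>f (z + t *\<^sub>R u) - poly P t\<bar> \<le> M * t powr \<alpha>"
      using holder_taylor[OF \<open>\<alpha> > 1\<close> _ ho bd u, of \<tau> z] \<open>M > 0\<close> z seg by (auto simp: k_def \<tau>_def)
    \<comment> \<open>The quadratic is \<open>(norm (q + t *\<^sub>R u))\<^sup>2 - a\<close>, as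
      \<open>u\<close> is a unit vector. The linear coefficient of \<open>Q\<close> is the quantity
      to be bounded.\<close>
    define Q where "Q = [:q \<bullet> q - a, 2 * (q \<bullet> u), 1:] + P * P"
    have "degree Q \<le> 2 * k"
      unfolding Q_def using \<open>k \<ge> 1\<close> P(1) degree_mult_le[of P P] by (intro degree_add_le) auto
    moreover have "\<bar>poly Q t\<bar> \<le> (4 + 3 * M\<^sup>2) * \<delta>" if t: "t \<in> {0..\<tau>}" for t
    proof -
      let ?y = "f (z + t *\<^sub>R u)" and ?p = "poly P t"
      have "\<bar>?y\<bar> \<le> M"
        using iter_dir_deriv_bound[OF bd, of "[]" 0 "z + t *\<^sub>R u"] seg t \<open>M > 0\<close>
        by (simp add: unit_lists_def \<tau>_def)
      have t\<delta>: "t powr \<alpha> \<le> \<delta>" using powr_mono2[of \<alpha> t \<tau>] \<tau> t \<open>\<alpha> > 1\<close> by simp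
      have "t powr \<alpha> \<le> 1" using powr_mono2[of \<alpha> t 1] \<tau> t \<open>\<alpha> > 1\<close> by simp
      have d1: "\<bar>?y - ?p\<bar> \<le> M * \<delta>"
        using tay[OF t] t\<delta> \<open>M > 0\<close> by (meson mult_left_mono order_less_imp_le order_trans)
      have "\<bar>?y - ?p\<bar> \<le> M * 1"
        using tay[OF t] \<open>t powr \<alpha> \<le> 1\<close> \<open>M > 0\<close> by (meson mult_left_mono order_less_imp_le order_trans)
      then have d2: "\<bar>?y + ?p\<bar> \<le> 3 * M" using \<open>\<bar>?y\<bar> \<le> M\<close> by linarith
      have "(norm (q + t *\<^sub>R u))\<^sup>2 = q \<bullet> q + 2 * (q \<bullet> u) * t + t\<^sup>2"
        unfolding power2_norm_eq_inner using u(2)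
        by (simp add: inner_add_left inner_add_right inner_commute norm_eq_1 power2_eq_square algebra_simps)
      then have "poly Q t = ((norm (q + t *\<^sub>R u))\<^sup>2 + ?y\<^sup>2 - a) - (?y - ?p) * (?y + ?p)"
        by (simp add: Q_def algebra_simps power2_eq_square)
      moreover have "\<bar>(?y - ?p) * (?y + ?p)\<bar> \<le> (M * \<delta>) * (3 * M)"
        unfolding abs_mult using d1 d2 \<open>M > 0\<close> \<open>0 < \<delta>\<close> by (intro mult_mono) auto
      ultimately have "\<bar>poly Q t\<bar> \<le> 4 * \<delta> + (M * \<delta>) * (3 * M)"
        using osc[of t] t by (auto simp: \<tau>_def)
      then show ?thesis by (simp add: algebra_simps power2_eq_square)
    qed
    ultimately have "\<bar>coeff Q 1\<bar> * \<tau> \<le> C * ((4 + 3 * M\<^sup>2) * \<delta>)" using C \<tau>(1) by blast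
    also have "\<dots> \<le> K * \<delta>" using \<delta> by (simp add: K_def mult.assoc[symmetric])
    also have "\<delta> = \<delta> powr (1 - 1/\<alpha>) * \<tau>" using \<delta> by (simp add: \<tau>_def powr_add[symmetric])
    finally have "\<bar>coeff Q 1\<bar> \<le> K * \<delta> powr (1 - 1/\<alpha>)" using \<tau>(1) by (simp add: mult.assoc[symmetric])
    moreover have "coeff Q 1 = 2 * (q \<bullet> u) + 2 * f z * dir_deriv u f z"
      using P by (simp add: Q_def coeff_mult)
    ultimately show ?thesis by simp
  qed
  moreover have "K \<ge> 1" by (simp add: K_def)
  ultimately show ?thesis by (intro exI[of _ K]) blast
qed

section \<open>Boundary charts\<close>

lemma subspace_orth_hyperplane: "subspace (orth_hyperplane w)"
  by (auto simp: subspace_def orth_hyperplane_def inner_simps)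

lemma local_subgraph_iff:
  assumes "local_subgraph \<Omega> p w \<rho> \<psi>" "y \<in> ball p \<rho>"
  shows "y \<in> \<Omega> \<longleftrightarrow> y \<bullet> w < \<psi> (tangent_proj w p y)"
  using assms unfolding local_subgraph_def by blast

lemma tangent_proj_in_disc:
  assumes "norm w = 1" "y \<in> ball p \<rho>"
  shows "tangent_proj w p y \<in> orth_hyperplane w \<inter> ball 0 \<rho>"
proof
  have w: "w \<bullet> w = 1" using assms by (simp add: norm_eq_1)
  show "tangent_proj w p y \<in> orth_hyperplane w"
    using w by (simp add: tangent_proj_def orth_hyperplane_def inner_simps)
  have "(norm (tangent_proj w p y))\<^sup>2 = (norm (y - p))\<^sup>2 - ((y - p) \<bullet> w)\<^sup>2"
    unfolding tangent_proj_def power2_norm_eq_inner using w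
    by (simp add: inner_diff_left inner_diff_right inner_commute power2_eq_square algebra_simps)
  then have "(norm (tangent_proj w p y))\<^sup>2 \<le> (norm (y - p))\<^sup>2" by simp
  then have "norm (tangent_proj w p y) \<le> norm (y - p)" by (rule power2_le_imp_le) simp
  then show "tangent_proj w p y \<in> ball 0 \<rho>" using assms(2) by (simp add: dist_norm norm_minus_commute)
qed

text \<open>Heights are measured from the origin, so the graph passes through \<open>p\<close> at
  height \<open>p \<bullet> w\<close>. A larger value of \<open>\<psi> 0\<close> would put
  \<open>p\<close> into the open set \<Omega>; a smaller one would, by continuity, give a
  neighbourhood of \<open>p\<close> missing \<Omega>.\<close>

lemma chart_base_point:
  fixes p :: "'a::euclidean_space"
  assumes "open \<Omega>" "p \<in> frontier \<Omega>" "norm w = 1" "0 < \<rho>"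
    and loc: "local_subgraph \<Omega> p w \<rho> \<psi>"
    and cont: "continuous_on (orth_hyperplane w \<inter> ball 0 \<rho>) \<psi>"
  shows "\<psi> 0 = p \<bullet> w"
proof (rule antisym)
  have "p \<notin> \<Omega>" using assms(1,2) by (simp add: frontier_def interior_open)
  moreover have "tangent_proj w p p = 0" by (simp add: tangent_proj_def)
  ultimately show "\<psi> 0 \<le> p \<bullet> w"
    using local_subgraph_iff[OF loc, of p] \<open>0 < \<rho>\<close> by simp
  show "p \<bullet> w \<le> \<psi> 0"
  proof (rule ccontr)
    assume "\<not> p \<bullet> w \<le> \<psi> 0"
    define h where "h y = y \<bullet> w - \<psi> (tangent_proj w p y)" for y
    have "continuous_on (ball p \<rho>) h"
      unfolding h_def
      by (intro continuous_intros continuous_on_compose2[OF cont])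
        (use tangent_proj_in_disc[OF \<open>norm w = 1\<close>] in \<open>auto simp: tangent_proj_def intro!: continuous_intros\<close>)
    then have "open {y \<in> ball p \<rho>. 0 < h y}"
      using continuous_open_preimage[of "ball p \<rho>" h "{0<..}"] by (simp add: vimage_def Int_def)
    moreover have "p \<in> {y \<in> ball p \<rho>. 0 < h y}"
      using \<open>\<not> p \<bullet> w \<le> \<psi> 0\<close> \<open>0 < \<rho>\<close> by (simp add: h_def tangent_proj_def)
    moreover have "p \<in> closure \<Omega>" using assms(2) by (simp add: frontier_def)
    ultimately have "\<Omega> \<inter> {y \<in> ball p \<rho>. 0 < h y} \<noteq> {}"
      using open_Int_closure_eq_empty by blast
    then show False using local_subgraph_iff[OF loc] by (auto simp: h_def)
  qed
qed

text \<open>The sum of squares is the squared norm of the graph point \<open>y\<close> over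
  \<open>z\<close>, split along and across \<open>w\<close>. That point is not in \<Omega>, hence
  not in the inner ball, but it is a limit of points of \<Omega> below it. The last hypothesis keeps
  \<open>y\<close> inside the chart.\<close>

lemma chart_graph_norm:
  fixes p :: "'a::euclidean_space"
  assumes "ball 0 r \<subseteq> \<Omega>" "\<Omega> \<subseteq> ball 0 R" "0 \<le> r" "norm w = 1"
    and loc: "local_subgraph \<Omega> p w \<rho> \<psi>"
    and z: "z \<in> orth_hyperplane w" "norm z + \<bar>\<psi> z - p \<bullet> w\<bar> < \<rho>"
  shows "r\<^sup>2 \<le> (norm (p - (p \<bullet> w) *\<^sub>R w + z))\<^sup>2 + (\<psi> z)\<^sup>2"
    and "(norm (p - (p \<bullet> w) *\<^sub>R w + z))\<^sup>2 + (\<psi> z)\<^sup>2 \<le> R\<^sup>2"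
proof -
  define y where "y = p + z + (\<psi> z - p \<bullet> w) *\<^sub>R w"
  have w: "w \<bullet> w = 1" "z \<bullet> w = 0" "w \<bullet> z = 0"
    using assms(4) z(1) by (simp_all add: norm_eq_1 orth_hyperplane_def inner_commute)
  have "norm (y - p) \<le> norm z + norm ((\<psi> z - p \<bullet> w) *\<^sub>R w)"
    using norm_triangle_ineq[of z "(\<psi> z - p \<bullet> w) *\<^sub>R w"] by (simp add: y_def add.assoc)
  then have yp: "norm (y - p) < \<rho>" using z(2) assms(4) by simp
  then have yb: "y \<in> ball p \<rho>" by (simp add: dist_norm norm_minus_commute)
  have yw: "y \<bullet> w = \<psi> z" using w by (simp add: y_def inner_simps)
  have proj: "tangent_proj w p (y - s *\<^sub>R w) = z" for s
    using w by (simp add: tangent_proj_def y_def inner_simps algebra_simps)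
  have ny: "(norm y)\<^sup>2 = (norm (p - (p \<bullet> w) *\<^sub>R w + z))\<^sup>2 + (\<psi> z)\<^sup>2"
    unfolding y_def power2_norm_eq_inner using w
    by (simp add: inner_simps inner_commute[of w p] inner_commute[of z p] power2_eq_square algebra_simps)
  have "y \<notin> \<Omega>" using local_subgraph_iff[OF loc yb] proj[of 0] yw by simp
  then have "r \<le> norm y" using assms(1) by (metis linorder_not_less mem_ball_0 subsetD)
  then show "r\<^sup>2 \<le> (norm (p - (p \<bullet> w) *\<^sub>R w + z))\<^sup>2 + (\<psi> z)\<^sup>2"
    unfolding ny[symmetric] using \<open>0 \<le> r\<close> by (rule power_mono)
  \<comment> \<open>Lowering \<open>y\<close> slightly, while staying in the chart, reaches
    \<Omega>; the shift \<open>s\<close> then tends to 0.\<close>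
  have push: "norm y \<le> R + s" if s: "0 < s" "s < \<rho> - norm (y - p)" for s
  proof -
    have "norm (y - s *\<^sub>R w - p) \<le> norm (y - p) + norm (s *\<^sub>R w)"
      using norm_triangle_ineq4[of "y - p" "s *\<^sub>R w"] by (simp add: algebra_simps)
    then have "y - s *\<^sub>R w \<in> ball p \<rho>" using s assms(4) by (simp add: dist_norm norm_minus_commute)
    moreover have "(y - s *\<^sub>R w) \<bullet> w < \<psi> (tangent_proj w p (y - s *\<^sub>R w))"
      unfolding proj using s w yw by (simp add: inner_simps)
    ultimately have "y - s *\<^sub>R w \<in> \<Omega>" using local_subgraph_iff[OF loc] by blast
    then have "norm (y - s *\<^sub>R w) < R" using assms(2) by auto
    then show ?thesis using norm_triangle_ineq2[of y "s *\<^sub>R w"] s assms(4) by simp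
  qed
  have "norm y \<le> R + s" if "0 < s" for s
  proof -
    have "norm y \<le> R + min s ((\<rho> - norm (y - p)) / 2)"
      by (rule push) (use that yp in \<open>auto simp: min_less_iff_disj\<close>)
    also have "\<dots> \<le> R + s" by simp
    finally show ?thesis .
  qed
  then have "norm y \<le> R" by (rule field_le_epsilon)
  then show "(norm (p - (p \<bullet> w) *\<^sub>R w + z))\<^sup>2 + (\<psi> z)\<^sup>2 \<le> R\<^sup>2"
    unfolding ny[symmetric] by (rule power_mono) simp
qed

text \<open>The segment from \<open>p\<close> to \<open>p - (\<rho> / 2) w\<close> enters \<open>\<Omega> \<subseteq> B\<^sub>R\<close>, although \<open>p\<close> lies outside \<open>B\<^sub>r\<close>.\<close>

lemma chart_base_point_height:
  fixes p :: "'a::euclidean_space"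
  assumes "p \<notin> \<Omega>" "ball 0 r \<subseteq> \<Omega>" "\<Omega> \<subseteq> ball 0 R" "0 \<le> r" "norm w = 1" "0 < \<rho>"
    and loc: "local_subgraph \<Omega> p w \<rho> \<psi>" and "\<psi> 0 = p \<bullet> w" and gap: "R\<^sup>2 - r\<^sup>2 \<le> \<rho>\<^sup>2 / 8"
  shows "\<rho> / 8 \<le> p \<bullet> w"
proof -
  define y where "y = p - (\<rho> / 2) *\<^sub>R w"
  have w: "w \<bullet> w = 1" using assms(5) by (simp add: norm_eq_1)
  have "tangent_proj w p y = 0" using w by (simp add: y_def tangent_proj_def)
  moreover have "y \<in> ball p \<rho>" using \<open>0 < \<rho>\<close> assms(5) by (simp add: y_def dist_norm)
  moreover have "y \<bullet> w < p \<bullet> w" using w \<open>0 < \<rho>\<close> by (simp add: y_def inner_simps)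
  ultimately have "y \<in> \<Omega>" using local_subgraph_iff[OF loc] \<open>\<psi> 0 = p \<bullet> w\<close> by simp
  then have "norm y < R" using assms(3) by auto
  then have "(norm y)\<^sup>2 \<le> R\<^sup>2" by (intro power_mono) auto
  moreover have "r \<le> norm p" using assms(1,2) by (metis linorder_not_less mem_ball_0 subsetD)
  then have "r\<^sup>2 \<le> (norm p)\<^sup>2" using \<open>0 \<le> r\<close> by (intro power_mono) auto
  moreover have "(norm y)\<^sup>2 = (norm p)\<^sup>2 - \<rho> * (p \<bullet> w) + \<rho>\<^sup>2 / 4"
    unfolding y_def power2_norm_eq_inner using w
    by (simp add: inner_simps inner_commute[of w p] power2_eq_square algebra_simps)
  \<comment> \<open>The gap hypothesis uses up half of the term
    \<open>\<rho>\<^sup>2 / 4\<close>.\<close>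
  ultimately have "\<rho> * (\<rho> / 8) \<le> \<rho> * (p \<bullet> w)" using gap by (simp add: power2_eq_square)
  then show ?thesis using \<open>0 < \<rho>\<close> by simp
qed

section \<open>Reflections and boundary crossings\<close>

lemma inner_reflection_diff:
  fixes x e :: "'a::euclidean_space"
  assumes "norm e = 1"
  shows "(norm x)\<^sup>2 - (norm (reflection e \<mu> x))\<^sup>2 = 4 * \<mu> * (x \<bullet> e - \<mu>)"
proof -
  have "e \<bullet> e = 1" using assms by (simp add: norm_eq_1)
  then show ?thesis unfolding reflection_def power2_norm_eq_inner
    by (simp add: inner_simps inner_commute[of e x] power2_eq_square algebra_simps)
qed

lemma segment_frontier:
  fixes e :: "'a::euclidean_space"
  assumes "x \<in> \<Omega>" "x - l *\<^sub>R e \<notin> \<Omega>" "0 \<le> l"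
  obtains b where "0 \<le> b" "b \<le> l" "x - b *\<^sub>R e \<in> frontier \<Omega>"
proof -
  let ?S = "closed_segment x (x - l *\<^sub>R e)"
  have "?S \<inter> frontier \<Omega> \<noteq> {}"
    by (rule connected_Int_frontier) (use assms in auto)
  then obtain t where t: "0 \<le> t" "t \<le> 1" "(1 - t) *\<^sub>R x + t *\<^sub>R (x - l *\<^sub>R e) \<in> frontier \<Omega>"
    by (auto simp: in_segment)
  moreover have "(1 - t) *\<^sub>R x + t *\<^sub>R (x - l *\<^sub>R e) = x - (t * l) *\<^sub>R e"
    by (simp add: algebra_simps)
  ultimately show thesis using that[of "t * l"] \<open>0 \<le> l\<close> by (simp add: mult_left_le_one_le)
qed

section \<open>The critical value\<close>

lemma outward_unit_normal_norm:
  assumes "outward_unit_normal \<Omega> x \<nu>"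
  shows "norm \<nu> = 1"
proof -
  obtain w g where "norm w = 1" "g \<in> orth_hyperplane w" "\<nu> = (w - g) /\<^sub>R norm (w - g)"
    using assms unfolding outward_unit_normal_def by blast
  \<comment> \<open>\<open>g\<close> is orthogonal to the unit vector \<open>w\<close>, so the
    normalised vector is nonzero.\<close>
  moreover from this have "w \<noteq> g" by (auto simp: orth_hyperplane_def)
  ultimately show ?thesis by simp
qed

text \<open>This is the upper half of the bound on the critical value. \<open>K\<close> comes from
  the interpolation estimate; \<open>\<delta>0\<close> makes the relevant lengths small compared
  with the chart radius.\<close>

lemma reflected_cap_subset:
  fixes \<alpha> M \<rho> :: real
  assumes "\<alpha> > 1" "M > 0" "\<rho> > 0"
  shows "\<exists>K\<ge>1. \<exists>\<delta>0>0. \<forall>(\<Omega> :: 'a::euclidean_space set) r R e \<mu>.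
    boundary_class \<alpha> M \<rho> \<Omega> \<and> ball 0 r \<subseteq> \<Omega> \<and> \<Omega> \<subseteq> ball 0 R \<and> 0 \<le> r \<and> r < R \<and> R \<le> 2 \<and>
    R - r \<le> \<delta>0 \<and> norm e = 1 \<and> K * (R - r) powr (1 - 1/\<alpha>) < \<mu> \<longrightarrow>
    reflected_cap \<Omega> e \<mu> \<subseteq> \<Omega>"
proof -
  obtain K where "K \<ge> 1" and K: "\<And>(T :: 'a set) U f u z q a \<delta>.
      holder_on \<alpha> T U f \<Longrightarrow> holder_norm \<alpha> T U f \<le> ennreal M \<Longrightarrow> u \<in> T \<Longrightarrow> norm u = 1 \<Longrightarrow> z \<in> U \<Longrightarrow>
      0 < \<delta> \<Longrightarrow> \<delta> powr (1/\<alpha>) \<le> 1 \<Longrightarrow>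
      (\<forall>t\<in>{0..\<delta> powr (1/\<alpha>)}. z + t *\<^sub>R u \<in> U \<and>
         \<bar>(norm (q + t *\<^sub>R u))\<^sup>2 + (f (z + t *\<^sub>R u))\<^sup>2 - a\<bar> \<le> 4 * \<delta>) \<Longrightarrow>
      \<bar>2 * (q \<bullet> u) + 2 * f z * dir_deriv u f z\<bar> \<le> K * \<delta> powr (1 - 1/\<alpha>)"
    using dir_deriv_almost_radial[OF assms(1,2), where 'a = 'a] by metis
  \<comment> \<open>\<open>\<tau>0\<close> ensures that points within \<open>3 * \<tau>\<close> of
    the chart centre stay in the chart together with their graph points, at nonnegative heights. The
    first bound in \<open>\<delta>0\<close> is the gap condition of
    \<open>chart_base_point_height\<close>; the second gives \<tau> \<le>
    \<open>\<tau>0\<close>.\<close>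
  define \<tau>0 where "\<tau>0 = min 1 (\<rho> / 24 / (1 + M))"
  define \<delta>0 where "\<delta>0 = min (\<rho>\<^sup>2 / 32) (\<tau>0 powr \<alpha>)"
  have "\<tau>0 * (1 + M) \<le> \<rho> / 24 / (1 + M) * (1 + M)"
    using assms by (intro mult_right_mono) (auto simp: \<tau>0_def)
  also have "\<dots> = \<rho> / 24" using assms by (intro nonzero_eq_divide_eq[THEN iffD1]) auto
  finally have "\<tau>0 * (1 + M) \<le> \<rho> / 24" .
  moreover have "0 < \<tau>0" "\<tau>0 \<le> 1" using assms by (simp_all add: \<tau>0_def)
  ultimately have \<tau>0: "0 < \<tau>0" "\<tau>0 \<le> 1" "\<tau>0 * (1 + M) \<le> \<rho> / 24" by blast+
  have "0 < \<delta>0" using assms \<tau>0 by (simp add: \<delta>0_def)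
  have "reflected_cap \<Omega> e \<mu> \<subseteq> \<Omega>"
    if bc: "boundary_class \<alpha> M \<rho> \<Omega>" and sub: "ball 0 r \<subseteq> \<Omega>" "\<Omega> \<subseteq> ball 0 R"
      and rR: "0 \<le> r" "r < R" "R \<le> 2" "R - r \<le> \<delta>0"
      and e: "norm e = 1" and \<mu>: "K * (R - r) powr (1 - 1/\<alpha>) < \<mu>"
    for \<Omega> :: "'a set" and r R e \<mu>
  proof (rule ccontr)
    assume "\<not> reflected_cap \<Omega> e \<mu> \<subseteq> \<Omega>"
    then obtain x where x: "x \<in> \<Omega>" "x \<bullet> e > \<mu>" "reflection e \<mu> x \<notin> \<Omega>"
      by (auto simp: reflected_cap_def)
    define \<delta> where "\<delta> = R - r"
    define \<eta> where "\<eta> = \<delta> powr (1 - 1/\<alpha>)"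
    define \<tau> where "\<tau> = \<delta> powr (1/\<alpha>)"
    define s where "s = x \<bullet> e - \<mu>"
    define x' where "x' = reflection e \<mu> x"
    have \<delta>: "0 < \<delta>" using rR by (simp add: \<delta>_def)
    have \<delta>_eq: "\<delta> = \<eta> * \<tau>" using \<delta> by (simp add: \<eta>_def \<tau>_def powr_add[symmetric])
    have \<eta>: "0 < \<eta>" "K * \<eta> < \<mu>" using \<delta> \<mu> by (simp_all add: \<eta>_def \<delta>_def)
    have "0 < \<mu>" using \<eta> \<open>K \<ge> 1\<close> by (smt (verit) mult_nonneg_nonneg)
    have "0 < s" using x by (simp add: s_def)
    have "\<delta> \<le> \<tau>0 powr \<alpha>" using rR by (simp add: \<delta>_def \<delta>0_def)
    then have "\<tau> \<le> (\<tau>0 powr \<alpha>) powr (1/\<alpha>)" unfolding \<tau>_def using \<delta> assms by (intro powr_mono2) auto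
    then have \<tau>: "0 < \<tau>" "\<tau> \<le> \<tau>0" using \<delta> assms \<tau>0 by (auto simp: \<tau>_def powr_powr)
    have gap: "R\<^sup>2 - r\<^sup>2 \<le> 4 * \<delta>"
    proof -
      have "(R - r) * (R + r) \<le> (R - r) * 4" using rR by (intro mult_left_mono) auto
      then show ?thesis by (simp add: \<delta>_def power2_eq_square algebra_simps)
    qed
    have diff: "(norm x)\<^sup>2 - (norm x')\<^sup>2 = 4 * \<mu> * s"
      unfolding x'_def s_def by (rule inner_reflection_diff[OF e])
    \<comment> \<open>As \<open>x'\<close> is outside the inner ball and \<open>x\<close> inside the
      outer one, \<open>\<mu> * s\<close> is at most \<delta> = \<open>\<eta> * \<tau>\<close>.
      Since \<mu> > \<eta>, this yields \<open>s \<le> \<tau>\<close>.\<close>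
    have "r \<le> norm x'" using x(3) sub(1) unfolding x'_def by (metis linorder_not_less mem_ball_0 subsetD)
    then have "r\<^sup>2 \<le> (norm x')\<^sup>2" using rR by (intro power_mono) auto
    moreover have "norm x < R" using x(1) sub(2) by auto
    then have "(norm x)\<^sup>2 \<le> R\<^sup>2" by (intro power_mono) auto
    ultimately have "\<mu> * s \<le> \<eta> * \<tau>" using diff gap \<delta>_eq by simp
    moreover have "\<eta> \<le> K * \<eta>" using \<eta> \<open>K \<ge> 1\<close> by simp
    then have "\<eta> * s \<le> \<mu> * s" using \<eta>(2) \<open>0 < s\<close> by simp
    ultimately have "s \<le> \<tau>" using \<eta>(1) by (meson mult_le_cancel_left_pos order_trans)
    have x'e: "x' = x - (2 * s) *\<^sub>R e" by (simp add: x'_def reflection_def s_def)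
    \<comment> \<open>The chart is centred at a boundary point between \<open>x\<close> and
      \<open>x'\<close>, so both lie within \<open>2 * s\<close> of its centre.\<close>
    obtain b where b: "0 \<le> b" "b \<le> 2 * s" and pf: "x - b *\<^sub>R e \<in> frontier \<Omega>"
      using segment_frontier[of x \<Omega> "2 * s" e] x x'e \<open>0 < s\<close> unfolding x'_def by auto
    define p where "p = x - b *\<^sub>R e"
    have pf: "p \<in> frontier \<Omega>" using pf by (simp add: p_def)
    obtain w where "\<exists>\<psi>. holder_on \<alpha> (orth_hyperplane w) (orth_hyperplane w \<inter> ball 0 \<rho>) \<psi> \<and>
             holder_norm \<alpha> (orth_hyperplane w) (orth_hyperplane w \<inter> ball 0 \<rho>) \<psi> \<le> ennreal M \<and>
             local_subgraph \<Omega> p w \<rho> \<psi>" and wn: "outward_unit_normal \<Omega> p w"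
      using bc pf unfolding boundary_class_def by blast
    then obtain \<psi> where ho: "holder_on \<alpha> (orth_hyperplane w) (orth_hyperplane w \<inter> ball 0 \<rho>) \<psi>"
      and bd: "holder_norm \<alpha> (orth_hyperplane w) (orth_hyperplane w \<inter> ball 0 \<rho>) \<psi> \<le> ennreal M"
      and loc: "local_subgraph \<Omega> p w \<rho> \<psi>" by blast
    have w: "norm w = 1" using outward_unit_normal_norm[OF wn] .
    then have ww: "w \<bullet> w = 1" by (simp add: norm_eq_1)
    have "open \<Omega>" using bc by (simp add: boundary_class_def)
    define T where "T = orth_hyperplane w"
    define U where "U = T \<inter> ball 0 \<rho>"
    have T: "subspace T" unfolding T_def by (rule subspace_orth_hyperplane)
    have "convex U" unfolding U_def using T by (simp add: convex_Int subspace_imp_convex)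
    have "0 \<in> U" using T assms by (simp add: U_def subspace_0)
    note ho = ho[folded T_def, folded U_def] and bd = bd[folded T_def, folded U_def]
    have \<psi>0: "\<psi> 0 = p \<bullet> w"
      using chart_base_point[OF \<open>open \<Omega>\<close> pf w \<open>\<rho> > 0\<close> loc] ho
      by (auto simp: holder_on_def T_def U_def intro: Ck_on_continuous)
    have lip: "\<bar>\<psi> z - p \<bullet> w\<bar> \<le> M * norm z" if "z \<in> U" for z
      using holder_lipschitz[OF \<open>\<alpha> > 1\<close> _ ho bd T \<open>convex U\<close> that \<open>0 \<in> U\<close>] \<open>M > 0\<close> that \<psi>0
      by (simp add: U_def)
    have "p \<notin> \<Omega>" using pf \<open>open \<Omega>\<close> by (simp add: frontier_def interior_open)
    have h: "\<rho> / 8 \<le> p \<bullet> w"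
    proof (rule chart_base_point_height[OF \<open>p \<notin> \<Omega>\<close> sub \<open>0 \<le> r\<close> w \<open>\<rho> > 0\<close> loc \<psi>0])
      have "\<delta> \<le> \<rho>\<^sup>2 / 32" using rR by (simp add: \<delta>_def \<delta>0_def)
      then show "R\<^sup>2 - r\<^sup>2 \<le> \<rho>\<^sup>2 / 8" using gap by simp
    qed
    \<comment> \<open>\<open>m\<close> is the part of \<open>p\<close> orthogonal to
      \<open>w\<close>, and \<open>G z\<close> is the squared norm of the graph point over
      \<open>z\<close>.\<close>
    define m where "m = p - (p \<bullet> w) *\<^sub>R w"
    define G where "G z = (norm (m + z))\<^sup>2 + (\<psi> z)\<^sup>2" for z
    have G: "r\<^sup>2 \<le> G z" "G z \<le> R\<^sup>2" if "z \<in> U" "norm z * (1 + M) < \<rho>" for z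
    proof -
      have "norm z + \<bar>\<psi> z - p \<bullet> w\<bar> < \<rho>" using lip[OF that(1)] that(2) by (simp add: algebra_simps)
      moreover have "z \<in> orth_hyperplane w" using that by (simp add: U_def T_def)
      ultimately show "r\<^sup>2 \<le> G z" "G z \<le> R\<^sup>2"
        using chart_graph_norm[OF sub \<open>0 \<le> r\<close> w loc, of z] by (simp_all add: G_def m_def)
    qed
    \<comment> \<open>Moving along \<open>e\<close> in space moves the base point in the chart along
      the tangential part \<open>v\<close> of \<open>e\<close>, which may vanish.\<close>
    define v where "v = e - (e \<bullet> w) *\<^sub>R w"
    have "v \<in> T" using ww by (simp add: v_def T_def orth_hyperplane_def inner_simps)
    have "(norm v)\<^sup>2 \<le> 1\<^sup>2"
      unfolding v_def power2_norm_eq_inner using ww e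
      by (simp add: inner_simps inner_commute[of w e] norm_eq_1 power2_eq_square algebra_simps)
    then have "norm v \<le> 1" by (rule power2_le_imp_le) simp
    have "\<tau> * (1 + M) \<le> \<tau>0 * (1 + M)" using \<tau>(2) \<open>M > 0\<close> by (intro mult_right_mono) auto
    then have small: "3 * \<tau> * (1 + M) \<le> \<rho> / 8" using \<tau>0(3) by linarith
    have "3 * \<tau> \<le> 3 * \<tau> * (1 + M)" using \<tau> \<open>M > 0\<close> by simp
    then have "3 * \<tau> < \<rho>" using small assms by linarith
    have U: "t *\<^sub>R v \<in> U" "norm (t *\<^sub>R v) \<le> 2 * s" if "\<bar>t\<bar> \<le> 2 * s" for t
    proof -
      have "\<bar>t\<bar> * norm v \<le> \<bar>t\<bar> * 1" using \<open>norm v \<le> 1\<close> by (intro mult_left_mono) auto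
      then show "norm (t *\<^sub>R v) \<le> 2 * s" using that by simp
      then show "t *\<^sub>R v \<in> U" using \<open>v \<in> T\<close> T \<open>s \<le> \<tau>\<close> \<open>3 * \<tau> < \<rho>\<close> \<open>0 < s\<close>
        by (auto simp: U_def subspace_scale)
    qed
    have pt: "p + t *\<^sub>R e \<in> ball p \<rho>" "tangent_proj w p (p + t *\<^sub>R e) = t *\<^sub>R v"
        "(norm (p + t *\<^sub>R e))\<^sup>2 = (norm (m + t *\<^sub>R v))\<^sup>2 + ((p + t *\<^sub>R e) \<bullet> w)\<^sup>2"
        "(p + t *\<^sub>R e) \<bullet> w \<ge> 0" "\<psi> (t *\<^sub>R v) \<ge> 0"
      if t: "\<bar>t\<bar> \<le> 2 * s" for t
    proof -
      show "p + t *\<^sub>R e \<in> ball p \<rho>"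
        using t \<open>s \<le> \<tau>\<close> \<open>3 * \<tau> < \<rho>\<close> \<open>0 < s\<close> e by (simp add: dist_norm)
      show "tangent_proj w p (p + t *\<^sub>R e) = t *\<^sub>R v"
        by (simp add: tangent_proj_def v_def algebra_simps)
      have "p + t *\<^sub>R e = (m + t *\<^sub>R v) + ((p + t *\<^sub>R e) \<bullet> w) *\<^sub>R w"
        by (simp add: m_def v_def inner_simps algebra_simps)
      moreover have "(m + t *\<^sub>R v) \<bullet> w = 0" using ww by (simp add: m_def v_def inner_simps)
      ultimately have "(norm (p + t *\<^sub>R e))\<^sup>2 = (norm (m + t *\<^sub>R v))\<^sup>2 + (norm (((p + t *\<^sub>R e) \<bullet> w) *\<^sub>R w))\<^sup>2"
        using norm_add_Pythagorean[of "m + t *\<^sub>R v" "((p + t *\<^sub>R e) \<bullet> w) *\<^sub>R w"] by (simp add: orthogonal_def)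
      then show "(norm (p + t *\<^sub>R e))\<^sup>2 = (norm (m + t *\<^sub>R v))\<^sup>2 + ((p + t *\<^sub>R e) \<bullet> w)\<^sup>2"
        using w by simp
      \<comment> \<open>The height at \<open>p\<close> is at least \<open>\<rho> / 8\<close> and
        changes by less than that. Nonnegativity of heights and of \<psi> is what later allows the
        inequalities to be squared.\<close>
      have "\<bar>e \<bullet> w\<bar> \<le> 1" using Cauchy_Schwarz_ineq2[of e w] e w by simp
      then have "\<bar>t\<bar> * \<bar>e \<bullet> w\<bar> \<le> (2 * s) * 1" using t by (intro mult_mono) auto
      then have "\<bar>t * (e \<bullet> w)\<bar> \<le> 2 * \<tau>" using \<open>s \<le> \<tau>\<close> by (simp add: abs_mult)
      then show "(p + t *\<^sub>R e) \<bullet> w \<ge> 0"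
        unfolding inner_add_left inner_scaleR_left
        using h small \<open>3 * \<tau> \<le> 3 * \<tau> * (1 + M)\<close> \<tau>(1) by linarith
      have "M * norm (t *\<^sub>R v) \<le> M * (2 * \<tau>)"
        using U(2)[OF t] \<open>s \<le> \<tau>\<close> \<open>M > 0\<close> by (intro mult_left_mono) linarith+
      also have "\<dots> \<le> 3 * \<tau> * (1 + M)" using \<tau>(1) \<open>M > 0\<close> by (simp add: algebra_simps)
      finally show "\<psi> (t *\<^sub>R v) \<ge> 0" using lip[OF U(1)[OF t]] h small by linarith
    qed
    have xb: "x = p + b *\<^sub>R e" and xb': "x' = p + (b - 2 * s) *\<^sub>R e"
      by (simp_all add: p_def x'e algebra_simps)
    have tb: "\<bar>b\<bar> \<le> 2 * s" "\<bar>b - 2 * s\<bar> \<le> 2 * s" using b by auto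
    \<comment> \<open>\<open>x\<close> lies below the graph and \<open>x'\<close> on or above it.
      Passing to the graph raises the norm of the first and lowers that of the second, so
      \<open>G\<close> grows by at least \<open>4 * \<mu> * s\<close>.\<close>
    have "x \<bullet> w \<le> \<psi> (b *\<^sub>R v)"
      using local_subgraph_iff[OF loc pt(1)[OF tb(1)]] x(1) xb pt(2)[OF tb(1)] by simp
    then have "(x \<bullet> w)\<^sup>2 \<le> (\<psi> (b *\<^sub>R v))\<^sup>2" using pt(4)[OF tb(1)] xb by (intro power_mono) auto
    then have Gx: "(norm x)\<^sup>2 \<le> G (b *\<^sub>R v)" using pt(3)[OF tb(1)] xb by (simp add: G_def)
    have "\<psi> ((b - 2 * s) *\<^sub>R v) \<le> x' \<bullet> w"
      using local_subgraph_iff[OF loc pt(1)[OF tb(2)]] x(3) xb' pt(2)[OF tb(2)] by (simp add: x'_def)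
    then have "(\<psi> ((b - 2 * s) *\<^sub>R v))\<^sup>2 \<le> (x' \<bullet> w)\<^sup>2" using pt(5)[OF tb(2)] by (intro power_mono)
    then have Gx': "G ((b - 2 * s) *\<^sub>R v) \<le> (norm x')\<^sup>2" using pt(3)[OF tb(2)] xb' by (simp add: G_def)
    \<comment> \<open>Mean value theorem in the unit direction of \<open>v\<close>, with the
      derivative bounded by interpolation at every point of the segment.\<close>
    have "G (b *\<^sub>R v) - G ((b - 2 * s) *\<^sub>R v) \<le> 2 * s * (K * \<eta>)"
    proof (cases "v = 0")
      case True
      then show ?thesis using \<open>0 < s\<close> \<open>0 < \<eta>\<close> \<open>K \<ge> 1\<close> by simp
    next
      case False
      define u where "u = v /\<^sub>R norm v"
      have u: "u \<in> T" "norm u = 1" "v = norm v *\<^sub>R u"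
        using False \<open>v \<in> T\<close> T by (simp_all add: u_def subspace_scale)
      define g where "g t = G (t *\<^sub>R u)" for t
      define g' where "g' t = 2 * ((m + t *\<^sub>R u) \<bullet> u) + 2 * \<psi> (t *\<^sub>R u) * dir_deriv u \<psi> (t *\<^sub>R u)" for t
      define lo hi where "lo = (b - 2 * s) * norm v" and "hi = b * norm v"
      have range: "t *\<^sub>R u \<in> U" "\<bar>t\<bar> \<le> 2 * s" if "t \<in> {lo..hi}" for t
      proof -
        have "b - 2 * s \<le> t / norm v" "t / norm v \<le> b"
          using that False by (simp_all add: lo_def hi_def pos_le_divide_eq pos_divide_le_eq)
        then have "\<bar>t / norm v\<bar> \<le> 2 * s" using b by linarith
        note * = U[OF this]
        have tu: "(t / norm v) *\<^sub>R v = t *\<^sub>R u" by (simp add: u_def divide_inverse)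
        show "t *\<^sub>R u \<in> U" using *(1) by (simp only: tu)
        show "\<bar>t\<bar> \<le> 2 * s" using *(2) u(2) unfolding tu by simp
      qed
      have "\<bar>g' t\<bar> \<le> K * \<eta>" if t: "t \<in> {lo..hi}" for t
        unfolding g'_def \<eta>_def
      \<comment> \<open>The interpolation looks ahead by \<tau> from a point within
        \<open>2 * s\<close> of the centre, which explains the radius
        \<open>3 * \<tau>\<close>.\<close>
      proof (rule K[OF ho bd u(1,2) range(1)[OF t] \<delta>, where a = "r\<^sup>2"])
        show "\<delta> powr (1/\<alpha>) \<le> 1" using \<tau> \<tau>0 by (simp add: \<tau>_def)
        show "\<forall>s\<in>{0..\<delta> powr (1/\<alpha>)}. t *\<^sub>R u + s *\<^sub>R u \<in> U \<and>
          \<bar>(norm (m + t *\<^sub>R u + s *\<^sub>R u))\<^sup>2 + (\<psi> (t *\<^sub>R u + s *\<^sub>R u))\<^sup>2 - r\<^sup>2\<bar> \<le> 4 * \<delta>"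
        proof
          fix s' assume s': "s' \<in> {0..\<delta> powr (1/\<alpha>)}"
          define z where "z = t *\<^sub>R u + s' *\<^sub>R u"
          have z: "z = (t + s') *\<^sub>R u" by (simp add: z_def scaleR_left_distrib)
          have nz: "norm z \<le> 3 * \<tau>"
          proof -
            have "0 \<le> s'" "s' \<le> \<tau>" using s' by (simp_all add: \<tau>_def)
            then have "\<bar>t + s'\<bar> \<le> 3 * \<tau>" using range(2)[OF t] \<open>s \<le> \<tau>\<close> by linarith
            then show ?thesis using u(2) by (simp add: z)
          qed
          then have "z \<in> U" using u(1) T \<open>3 * \<tau> < \<rho>\<close> by (simp add: z U_def subspace_scale)
          moreover have "norm z * (1 + M) < \<rho>"
            using mult_right_mono[OF nz, of "1 + M"] small \<open>M > 0\<close> \<open>\<rho> > 0\<close> by linarith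
          ultimately have "r\<^sup>2 \<le> G z" "G z \<le> R\<^sup>2" using G by blast+
          then show "t *\<^sub>R u + s' *\<^sub>R u \<in> U \<and>
              \<bar>(norm (m + t *\<^sub>R u + s' *\<^sub>R u))\<^sup>2 + (\<psi> (t *\<^sub>R u + s' *\<^sub>R u))\<^sup>2 - r\<^sup>2\<bar> \<le> 4 * \<delta>"
            using \<open>z \<in> U\<close> gap unfolding G_def z_def[symmetric] add.assoc by simp
        qed
      qed
      moreover have "(g has_real_derivative g' t) (at t)" if t: "t \<in> {lo..hi}" for t
      proof -
        have "((\<lambda>t. iter_dir_deriv (replicate 0 u) \<psi> (0 + t *\<^sub>R u)) has_real_derivative
            iter_dir_deriv (replicate (Suc 0) u) \<psi> (0 + t *\<^sub>R u)) (at t)"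
          using ho holder_order_ge_1[OF \<open>\<alpha> > 1\<close>] u(1) range(1)[OF t]
          by (intro iter_dir_deriv_line) (auto simp: holder_on_def)
        then have d: "((\<lambda>t. \<psi> (t *\<^sub>R u)) has_real_derivative dir_deriv u \<psi> (t *\<^sub>R u)) (at t)" by simp
        have "u \<bullet> u = 1" using u(2) by (simp add: norm_eq_1)
        then have "g = (\<lambda>t. m \<bullet> m + 2 * t * (m \<bullet> u) + t\<^sup>2 + (\<psi> (t *\<^sub>R u))\<^sup>2)"
          unfolding g_def G_def power2_norm_eq_inner
          by (simp add: fun_eq_iff inner_add_left inner_add_right inner_commute[of u m] power2_eq_square algebra_simps)
        moreover have "((\<lambda>t. m \<bullet> m + 2 * t * (m \<bullet> u) + t\<^sup>2 + (\<psi> (t *\<^sub>R u))\<^sup>2) has_real_derivative g' t) (at t)"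
          by (rule derivative_eq_intros d refl)+
            (use \<open>u \<bullet> u = 1\<close> in \<open>simp add: g'_def inner_add_left\<close>)
        ultimately show ?thesis by simp
      qed
      moreover have "lo < hi" using False \<open>0 < s\<close> by (simp add: lo_def hi_def)
      ultimately obtain t where "t \<in> {lo..hi}" "g hi - g lo = (hi - lo) * g' t" "\<bar>g' t\<bar> \<le> K * \<eta>"
        using MVT2[of lo hi g g'] by (metis atLeastAtMost_iff less_eq_real_def)
      then have "g hi - g lo \<le> (hi - lo) * (K * \<eta>)" using \<open>lo < hi\<close> by simp
      also have "\<dots> \<le> 2 * s * (K * \<eta>)"
        using \<open>norm v \<le> 1\<close> \<open>0 < s\<close> \<open>0 < \<eta>\<close> \<open>K \<ge> 1\<close>
        by (intro mult_right_mono) (auto simp: lo_def hi_def algebra_simps)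
      finally show ?thesis using u(3) by (simp add: g_def lo_def hi_def) (metis scaleR_scaleR)
    qed
    then have "4 * \<mu> * s \<le> 2 * s * (K * \<eta>)" using Gx Gx' diff by linarith
    then have "2 * \<mu> \<le> K * \<eta>" using \<open>0 < s\<close> by simp
    then show False using \<eta> \<open>0 < \<mu>\<close> by linarith
  qed
  with \<open>K \<ge> 1\<close> \<open>0 < \<delta>0\<close> show ?thesis by (intro exI[of _ K] conjI exI[of _ \<delta>0]) blast+
qed

text \<open>Below height \<open>(r - R) / 2\<close>, reflection carries some point of the inner ball
  on the axis of \<open>e\<close> out of the outer ball. The upper bound holds because
  \<open>c\<close> itself competes in the infimum.\<close>

lemma critical_value_bounds:
  fixes e :: "'a::euclidean_space"
  assumes "ball 0 r \<subseteq> \<Omega>" "\<Omega> \<subseteq> ball 0 R" "0 < r" "norm e = 1"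
    and cap: "\<And>\<mu>. c < \<mu> \<Longrightarrow> reflected_cap \<Omega> e \<mu> \<subseteq> \<Omega>"
  shows "r - R \<le> 2 * critical_value \<Omega> e" "critical_value \<Omega> e \<le> c"
proof -
  define \<Lambda> where "\<Lambda> = Sup ((\<lambda>x. x \<bullet> e) ` \<Omega>)"
  define A where "A = {m. \<forall>\<mu>\<in>{m<..<\<Lambda>}. reflected_cap \<Omega> e \<mu> \<subseteq> \<Omega>}"
  have crit: "critical_value \<Omega> e = Inf A" by (simp add: critical_value_def A_def \<Lambda>_def)
  have ee: "e \<bullet> e = 1" using assms(4) by (simp add: norm_eq_1)
  have "x \<bullet> e \<le> R" if "x \<in> \<Omega>" for x
  proof -
    have "norm x < R" using that assms(2) by auto
    then show ?thesis using norm_cauchy_schwarz[of x e] assms(4) by simp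
  qed
  then have bdd: "bdd_above ((\<lambda>x. x \<bullet> e) ` \<Omega>)" by (intro bdd_aboveI[of _ R]) auto
  have "(r / 2) *\<^sub>R e \<in> \<Omega>" using assms by auto
  then have "((r / 2) *\<^sub>R e) \<bullet> e \<le> \<Lambda>" unfolding \<Lambda>_def by (rule cSUP_upper[OF _ bdd])
  then have "0 < \<Lambda>" using \<open>0 < r\<close> ee by simp
  have lower: "(r - R) / 2 \<le> m" if "m \<in> A" for m
  proof (rule ccontr)
    assume m: "\<not> (r - R) / 2 \<le> m"
    have "0 \<in> \<Omega>" using assms(1,3) by auto
    have "0 < R" using \<open>0 \<in> \<Omega>\<close> assms(2) by auto
    have "r \<le> R"
    proof (rule ccontr)
      assume "\<not> r \<le> R"
      with \<open>0 < R\<close> assms(4) have "R *\<^sub>R e \<in> ball 0 r" by simp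
      then have "R *\<^sub>R e \<in> ball 0 R" using assms(1,2) by blast
      then show False using assms(4) by simp
    qed
    \<comment> \<open>Membership of \<open>m\<close> in \<open>A\<close> only concerns heights
      strictly above \<open>m\<close>.\<close>
    from m obtain \<mu> where "m < \<mu>" "\<mu> < (r - R) / 2" using dense by (metis not_le)
    then have \<mu>: "m < \<mu>" "2 * \<mu> < r - R" by simp_all
    then have "\<mu> < 0" using \<open>r \<le> R\<close> by linarith
    then have sub: "reflected_cap \<Omega> e \<mu> \<subseteq> \<Omega>" using that \<open>0 < \<Lambda>\<close> \<mu> by (auto simp: A_def)
    \<comment> \<open>The reflected point has norm \<open>t - 2 * \<mu>\<close>, which must reach
      \<open>R\<close> with \<open>t < r\<close>; the maximum with 0 covers very negative
      \<mu>.\<close>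
    define t where "t = max 0 (R + 2 * \<mu>)"
    have t: "0 \<le> t" "t < r" "R \<le> t - 2 * \<mu>" using \<mu> \<open>0 < r\<close> by (auto simp: t_def max_def)
    then have "t *\<^sub>R e \<in> \<Omega>" using assms by auto
    moreover have "(t *\<^sub>R e) \<bullet> e > \<mu>" using ee t \<open>\<mu> < 0\<close> by simp
    ultimately have "reflection e \<mu> (t *\<^sub>R e) \<in> \<Omega>" using sub by (auto simp: reflected_cap_def)
    moreover have "reflection e \<mu> (t *\<^sub>R e) = (2 * \<mu> - t) *\<^sub>R e"
      using ee by (simp add: reflection_def scaleR_left_diff_distrib[symmetric])
    ultimately have "norm ((2 * \<mu> - t) *\<^sub>R e) < R" using assms(2) by auto
    then show False using assms(4) t \<open>\<mu> < 0\<close> by simp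
  qed
  \<comment> \<open>The interval of heights is empty here, so \<open>A\<close> is nonempty and its
    infimum is meaningful.\<close>
  have "\<Lambda> \<in> A" by (simp add: A_def)
  then have "(r - R) / 2 \<le> critical_value \<Omega> e"
    unfolding crit using lower by (intro cInf_greatest) auto
  then show "r - R \<le> 2 * critical_value \<Omega> e" by simp
  have "c \<in> A" using cap by (auto simp: A_def)
  then show "critical_value \<Omega> e \<le> c"
    unfolding crit by (rule cInf_lower[OF _ bdd_belowI[OF lower]])
qed

section \<open>Distance to the hyperplane and size of the critical value\<close>

lemma infdist_hyperplane_at:
  fixes e :: "'a::euclidean_space"
  assumes "norm e = 1"
  shows "infdist x (hyperplane_at e \<mu>) = \<bar>x \<bullet> e - \<mu>\<bar>"
proof (rule antisym)
  have ee: "e \<bullet> e = 1" using assms by (simp add: norm_eq_1)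
  let ?y = "x - (x \<bullet> e - \<mu>) *\<^sub>R e"
  have y: "?y \<in> hyperplane_at e \<mu>" using ee by (simp add: hyperplane_at_def inner_simps)
  from infdist_le[OF this, of x] show "infdist x (hyperplane_at e \<mu>) \<le> \<bar>x \<bullet> e - \<mu>\<bar>"
    using assms by (simp add: dist_norm)
  show "\<bar>x \<bullet> e - \<mu>\<bar> \<le> infdist x (hyperplane_at e \<mu>)"
    \<comment> \<open>\<open>infdist\<close> to the empty set is 0 by convention; the foot point
      \<open>?y\<close> rules this case out.\<close>
    unfolding infdist_def
  proof (simp, intro conjI impI)
    show "\<bar>x \<bullet> e - \<mu>\<bar> \<le> (INF a\<in>hyperplane_at e \<mu>. dist x a)"
    proof (rule cINF_greatest)
      show "\<bar>x \<bullet> e - \<mu>\<bar> \<le> dist x a" if "a \<in> hyperplane_at e \<mu>" for a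
        using that Cauchy_Schwarz_ineq2[of "x - a" e] assms
        by (simp add: hyperplane_at_def inner_simps dist_norm)
    qed (use y in blast)
  qed (use y in blast)
qed

lemma reflection_involution:
  assumes "norm e = 1"
  shows "reflection e \<mu> (reflection e \<mu> x) = x"
  using assms by (simp add: reflection_def inner_simps norm_eq_1 algebra_simps)

lemma mem_reflection_image:
  assumes "norm e = 1"
  shows "x \<in> reflection e \<mu> ` \<Omega> \<longleftrightarrow> reflection e \<mu> x \<in> \<Omega>"
  using reflection_involution[OF assms] by (metis imageE imageI)

text \<open>This lets errors linear in the gap be absorbed into \<eta>; the remaining factor
  \<open>\<delta> powr (1/\<alpha>)\<close> is at most 2.\<close>

lemma powr_interpolation_gap:
  fixes \<alpha> \<delta> :: real
  assumes "\<alpha> > 1" "0 \<le> \<delta>" "\<delta> \<le> 2"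
  shows "\<delta> \<le> 2 * \<delta> powr (1 - 1/\<alpha>)"
proof (cases "\<delta> = 0")
  case False
  with assms have "\<delta> = \<delta> powr (1 - 1/\<alpha>) * \<delta> powr (1/\<alpha>)" by (simp add: powr_add[symmetric])
  moreover have "\<delta> powr (1/\<alpha>) \<le> 2 powr (1/\<alpha>)" using assms by (intro powr_mono2) auto
  moreover have "2 powr (1/\<alpha>) \<le> 2 powr (1::real)" using assms by (intro powr_mono) auto
  ultimately have "\<delta> \<le> \<delta> powr (1 - 1/\<alpha>) * 2"
    by (metis mult_left_mono order_trans powr_ge_zero powr_one zero_le_numeral)
  then show ?thesis by simp
qed simp

lemma critical_value_abs_bound:
  fixes \<alpha> M \<rho> :: real
  assumes "\<alpha> > 1" "M > 0" "\<rho> > 0"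
  shows "\<exists>K>0. \<forall>(\<Omega> :: 'a::euclidean_space set) r R e.
    boundary_class \<alpha> M \<rho> \<Omega> \<and> ball 0 r \<subseteq> \<Omega> \<and> \<Omega> \<subseteq> ball 0 R \<and> 0 < r \<and> r \<le> R \<and> R \<le> 2 \<and>
    norm e = 1 \<and> \<bar>critical_value \<Omega> e\<bar> \<le> 1 \<longrightarrow>
    \<bar>critical_value \<Omega> e\<bar> \<le> K * (R - r) powr (1 - 1/\<alpha>)"
proof -
  obtain K \<delta>0 where "K \<ge> 1" "\<delta>0 > 0" and K: "\<And>(\<Omega> :: 'a set) r R e \<mu>.
    boundary_class \<alpha> M \<rho> \<Omega> \<Longrightarrow> ball 0 r \<subseteq> \<Omega> \<Longrightarrow> \<Omega> \<subseteq> ball 0 R \<Longrightarrow> 0 \<le> r \<Longrightarrow> r < R \<Longrightarrow> R \<le> 2 \<Longrightarrow>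
    R - r \<le> \<delta>0 \<Longrightarrow> norm e = 1 \<Longrightarrow> K * (R - r) powr (1 - 1/\<alpha>) < \<mu> \<Longrightarrow>
    reflected_cap \<Omega> e \<mu> \<subseteq> \<Omega>"
    using reflected_cap_subset[OF assms, where 'a = 'a] by metis
  \<comment> \<open>The second summand serves gaps larger than \<open>\<delta>0\<close>, where the a
    priori bound 1 on the critical value suffices.\<close>
  define L where "L = K + 1 / \<delta>0 powr (1 - 1/\<alpha>)"
  have L: "K \<le> L" "1 / \<delta>0 powr (1 - 1/\<alpha>) \<le> L" using \<open>K \<ge> 1\<close> by (simp_all add: L_def)
  have "\<bar>critical_value \<Omega> e\<bar> \<le> L * (R - r) powr (1 - 1/\<alpha>)"
    if bc: "boundary_class \<alpha> M \<rho> \<Omega>" and sub: "ball 0 r \<subseteq> \<Omega>" "\<Omega> \<subseteq> ball 0 R"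
      and rR: "0 < r" "r \<le> R" "R \<le> 2" and e: "norm e = 1" and le: "\<bar>critical_value \<Omega> e\<bar> \<le> 1"
    for \<Omega> :: "'a set" and r R e
  proof -
    define \<eta> where "\<eta> = (R - r) powr (1 - 1/\<alpha>)"
    have "\<eta> \<ge> 0" by (simp add: \<eta>_def)
    have gap: "R - r \<le> 2 * \<eta>" unfolding \<eta>_def using assms(1) rR by (intro powr_interpolation_gap) auto
    consider "r = R" | "r < R" "R - r \<le> \<delta>0" | "\<delta>0 < R - r" using rR by linarith
    then have "\<bar>critical_value \<Omega> e\<bar> \<le> L * \<eta>"
    proof cases
      \<comment> \<open>Here \<eta> = 0, so the critical value must vanish exactly: \<Omega> is a
        ball, and reflecting a cap at positive height decreases norms.\<close>
      case 1
      have cap: "reflected_cap \<Omega> e \<mu> \<subseteq> \<Omega>" if "0 < \<mu>" for \<mu>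
      proof
        fix y assume "y \<in> reflected_cap \<Omega> e \<mu>"
        then obtain x where x: "x \<in> \<Omega>" "x \<bullet> e > \<mu>" "y = reflection e \<mu> x"
          by (auto simp: reflected_cap_def)
        have "0 < 4 * \<mu> * (x \<bullet> e - \<mu>)" using x that by simp
        then have "(norm y)\<^sup>2 < (norm x)\<^sup>2" using inner_reflection_diff[OF e, of x \<mu>] x(3) by simp
        then have "norm y < norm x" by (rule power2_less_imp_less) simp
        moreover have "norm x < R" using x(1) sub(2) by auto
        ultimately have "y \<in> ball 0 r" using 1 by simp
        then show "y \<in> \<Omega>" using sub(1) by blast
      qed
      have "r - R \<le> 2 * critical_value \<Omega> e" "critical_value \<Omega> e \<le> 0"
        using critical_value_bounds[OF sub rR(1) e cap] by blast+
      then show ?thesis using 1 L \<open>K \<ge> 1\<close> \<open>\<eta> \<ge> 0\<close> by simp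
    next
      case 2
      have cap: "reflected_cap \<Omega> e \<mu> \<subseteq> \<Omega>" if "K * \<eta> < \<mu>" for \<mu>
        using K[OF bc sub _ 2(1) rR(3) 2(2) e] rR that by (simp add: \<eta>_def)
      have "r - R \<le> 2 * critical_value \<Omega> e" "critical_value \<Omega> e \<le> K * \<eta>"
        using critical_value_bounds[OF sub rR(1) e cap] by blast+
      moreover have "1 * \<eta> \<le> K * \<eta>" "K * \<eta> \<le> L * \<eta>"
        by (intro mult_right_mono L(1) \<open>K \<ge> 1\<close> \<open>\<eta> \<ge> 0\<close>)+
      ultimately show ?thesis using gap by linarith
    next
      case 3
      have "\<delta>0 powr (1 - 1/\<alpha>) \<le> \<eta>"
        unfolding \<eta>_def using 3 \<open>\<delta>0 > 0\<close> assms(1) by (intro powr_mono2) auto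
      then have "1 \<le> 1 / \<delta>0 powr (1 - 1/\<alpha>) * \<eta>" using \<open>\<delta>0 > 0\<close> by simp
      also have "\<dots> \<le> L * \<eta>" using L \<open>\<eta> \<ge> 0\<close> by (intro mult_right_mono)
      finally show ?thesis using le by linarith
    qed
    then show ?thesis by (simp add: \<eta>_def)
  qed
  moreover have "L > 0" using L \<open>K \<ge> 1\<close> by linarith
  ultimately show ?thesis by blast
qed

section \<open>Thin shells in a slab\<close>

lemma disjoint_translates_measure:
  fixes S D :: "'a::euclidean_space set"
  assumes S: "S \<in> lmeasurable" and D: "D \<in> lmeasurable"
    and sub: "\<And>m x. m < N \<Longrightarrow> x \<in> S \<Longrightarrow> real m *\<^sub>R b + x \<in> D"
    and disj: "\<And>k x. 1 \<le> k \<Longrightarrow> x \<in> S \<Longrightarrow> x + real k *\<^sub>R b \<notin> S"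
  shows "real N * measure lebesgue S \<le> measure lebesgue D"
proof -
  define F where "F m = (+) (real m *\<^sub>R b) ` S" for m
  have F: "F m \<in> lmeasurable" "measure lebesgue (F m) = measure lebesgue S" for m
    using S by (simp_all add: F_def measurable_translation measure_translation)
  have aux: "F m \<inter> F l = {}" if "m < l" for m l
  proof (rule ccontr)
    assume "F m \<inter> F l \<noteq> {}"
    then obtain x y where xy: "x \<in> S" "y \<in> S" "real m *\<^sub>R b + x = real l *\<^sub>R b + y"
      by (auto simp: F_def)
    then have "x = y + real (l - m) *\<^sub>R b" using that by (simp add: of_nat_diff algebra_simps)
    then show False using disj[of "l - m" y] xy that by simp
  qed
  then have "disjoint_family_on F {..<N}"
    unfolding disjoint_family_on_def by (metis Int_commute linorder_neqE_nat)
  then have "measure lebesgue (\<Union>m<N. F m) = (\<Sum>m<N. measure lebesgue (F m))"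
    using F(1) by (intro measure_UNION') (auto simp: pairwise_def disjnt_def disjoint_family_on_def)
  also have "\<dots> = real N * measure lebesgue S" by (simp add: F)
  finally have "real N * measure lebesgue S = measure lebesgue (\<Union>m<N. F m)" by simp
  also have "\<dots> \<le> measure lebesgue D"
    using F(1) D sub by (intro measure_mono_fmeasurable) (auto simp: F_def)
  finally show ?thesis .
qed

text \<open>A packing argument in place of Fubini. For \<open>h\<close> slightly above the thickness
  \<open>l\<close>, about \<open>1 / h\<close> translates of \<open>S\<close> by multiples of
  \<open>h *\<^sub>R b\<close> are disjoint and fit into \<open>D\<close>; then \<open>h\<close>
  decreases to \<open>l\<close>.\<close>

lemma measure_le_thickness:
  fixes S D :: "'a::euclidean_space set"
  assumes S: "S \<in> lmeasurable" and D: "D \<in> lmeasurable" and "0 \<le> l"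
    and sub: "\<And>t x. 0 \<le> t \<Longrightarrow> t \<le> 1 \<Longrightarrow> x \<in> S \<Longrightarrow> x + t *\<^sub>R b \<in> D"
    and thin: "\<And>h x. l < h \<Longrightarrow> x \<in> S \<Longrightarrow> x + h *\<^sub>R b \<notin> S"
  shows "measure lebesgue S \<le> l * measure lebesgue D"
proof -
  have *: "measure lebesgue S \<le> h * measure lebesgue D" if "l < h" for h
  proof -
    have "0 < h" using that \<open>0 \<le> l\<close> by simp
    \<comment> \<open>Every index \<open>m < N\<close> satisfies \<open>m * h < 1\<close>, so the
      translates stay in \<open>D\<close>, while \<open>N\<close> is still at least
      \<open>1 / h\<close>.\<close>
    define N where "N = nat \<lceil>1 / h\<rceil>"
    have N: "1 / h \<le> real N" using \<open>0 < h\<close> by (simp add: N_def of_nat_ceiling)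
    have "real N * measure lebesgue S \<le> measure lebesgue D"
    proof (rule disjoint_translates_measure[OF S D, of N "h *\<^sub>R b"])
      fix m x assume "m < N" "x \<in> S"
      have "real m < 1 / h" using \<open>m < N\<close> unfolding N_def by linarith
      then have "real m * h \<le> 1" using \<open>0 < h\<close> by (simp add: field_simps)
      then show "real m *\<^sub>R h *\<^sub>R b + x \<in> D"
        using sub[of "real m * h" x] \<open>0 < h\<close> \<open>x \<in> S\<close> by (simp add: add.commute)
    next
      fix k :: nat and x assume "1 \<le> k" "x \<in> S"
      have "1 * h \<le> real k * h" using \<open>1 \<le> k\<close> \<open>0 < h\<close> by (intro mult_right_mono) auto
      then show "x + real k *\<^sub>R h *\<^sub>R b \<notin> S" using thin[of "real k * h" x] that \<open>x \<in> S\<close> by simp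
    qed
    then have "1 / h * measure lebesgue S \<le> measure lebesgue D"
      using N by (meson measure_nonneg mult_right_mono order_trans)
    then show ?thesis using \<open>0 < h\<close> by (simp add: field_simps)
  qed
  have "measure lebesgue S \<le> l * measure lebesgue D + \<epsilon>" if "0 < \<epsilon>" for \<epsilon>
  proof -
    have pos: "0 < measure lebesgue D + 1" by (simp add: add_nonneg_pos)
    \<comment> \<open>Adding 1 avoids division by zero when \<open>D\<close> is a null set.\<close>
    have "measure lebesgue S \<le> (l + \<epsilon> / (measure lebesgue D + 1)) * measure lebesgue D"
      using pos that by (intro *) simp
    also have "\<dots> = l * measure lebesgue D + \<epsilon> * (measure lebesgue D / (measure lebesgue D + 1))"
      by (simp add: algebra_simps)
    also have "\<dots> \<le> l * measure lebesgue D + \<epsilon> * 1"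
      using pos that by (intro add_left_mono mult_left_mono) (auto simp: divide_le_eq)
    finally show ?thesis by simp
  qed
  then show ?thesis by (rule field_le_epsilon)
qed

lemma slab_lmeasurable: "{x :: 'a::euclidean_space. norm x \<le> k \<and> \<bar>x \<bullet> e - \<mu>\<bar> \<le> \<gamma>} \<in> lmeasurable"
proof (rule lmeasurable_compact)
  have "closed {x :: 'a. norm x \<le> k \<and> \<bar>x \<bullet> e - \<mu>\<bar> \<le> \<gamma>}"
    by (intro closed_Collect_conj closed_Collect_le continuous_intros)
  then show "compact {x :: 'a. norm x \<le> k \<and> \<bar>x \<bullet> e - \<mu>\<bar> \<le> \<gamma>}"
    by (auto simp: compact_eq_bounded_closed bounded_iff)
qed

text \<open>The slab has thickness \<open>2 * \<gamma>\<close> in direction \<open>e\<close>, and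
  unit shifts enlarge the ball by 1.\<close>

lemma slab_measure:
  fixes e :: "'a::euclidean_space"
  assumes "norm e = 1" "0 < \<gamma>"
  shows "measure lebesgue {x. norm x \<le> k \<and> \<bar>x \<bullet> e - \<mu>\<bar> \<le> \<gamma>} \<le> (2 * \<gamma>) * measure lebesgue (cball (0 :: 'a) (k + 1))"
proof (rule measure_le_thickness[where b = e])
  have ee: "e \<bullet> e = 1" using assms by (simp add: norm_eq_1)
  fix x :: 'a assume x: "x \<in> {x. norm x \<le> k \<and> \<bar>x \<bullet> e - \<mu>\<bar> \<le> \<gamma>}"
  show "x + t *\<^sub>R e \<in> cball 0 (k + 1)" if "0 \<le> t" "t \<le> 1" for t
    using x that norm_triangle_ineq[of x "t *\<^sub>R e"] assms by simp
  show "x + h *\<^sub>R e \<notin> {x. norm x \<le> k \<and> \<bar>x \<bullet> e - \<mu>\<bar> \<le> \<gamma>}" if "2 * \<gamma> < h" for h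
    using x that ee by (simp add: inner_simps abs_le_iff)
qed (use assms slab_lmeasurable in auto)

text \<open>For a unit vector \<open>e\<close>, the last condition bounds from below the component
  of \<open>x\<close> orthogonal to \<open>e\<close>. It keeps away from the poles of the shell,
  where the slab and the shell are nearly parallel.\<close>

definition shell_slab :: "'a::euclidean_space \<Rightarrow> real \<Rightarrow> real \<Rightarrow> real \<Rightarrow> real \<Rightarrow> real \<Rightarrow> 'a set" where
  "shell_slab e \<mu> \<gamma> A B a = {x. \<bar>x \<bullet> e - \<mu>\<bar> \<le> \<gamma> \<and> A \<le> (norm x)\<^sup>2 \<and> (norm x)\<^sup>2 \<le> B \<and>
     a \<le> (norm x)\<^sup>2 - (x \<bullet> e)\<^sup>2}"

lemma shell_slab_lmeasurable: "shell_slab e \<mu> \<gamma> A B a \<in> lmeasurable"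
proof (rule lmeasurable_compact)
  have "closed (shell_slab e \<mu> \<gamma> A B a)"
    unfolding shell_slab_def by (intro closed_Collect_conj closed_Collect_le continuous_intros)
  moreover have "norm x \<le> sqrt B" if "(norm x)\<^sup>2 \<le> B" for x :: 'a
    using that by (simp add: real_le_rsqrt)
  then have "bounded (shell_slab e \<mu> \<gamma> A B a)" by (auto simp: shell_slab_def bounded_iff)
  ultimately show "compact (shell_slab e \<mu> \<gamma> A B a)" by (simp add: compact_eq_bounded_closed)
qed

text \<open>On a piece of the shell where the component of \<open>x\<close> along some direction orthogonal to \<open>e\<close>
  is bounded below, \<open>(norm x)\<^sup>2\<close> grows at a definite rate in that direction, so the piece is thin there.\<close>

lemma shell_slab_measure:
  fixes e :: "'a::euclidean_space" and c :: real
  assumes "norm e = 1" "0 < \<gamma>" "0 < c" "A \<le> B" "B \<le> k\<^sup>2" "0 \<le> k"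
  shows "measure lebesgue (shell_slab e \<mu> \<gamma> A B (DIM('a) * c\<^sup>2))
    \<le> DIM('a) * ((B - A) / c * (2 * \<gamma> * measure lebesgue (cball (0 :: 'a) (k + 2))))"
proof -
  have ee: "e \<bullet> e = 1" using assms by (simp add: norm_eq_1)
  define D where "D = {x :: 'a. norm x \<le> k + 1 \<and> \<bar>x \<bullet> e - \<mu>\<bar> \<le> \<gamma>}"
  \<comment> \<open>Projected basis vectors: shifts along them preserve the distance to the
    hyperplane, and norms at most 1 suffice.\<close>
  define b where "b i = i - (i \<bullet> e) *\<^sub>R e" for i :: 'a
  define W where "W v = {x. \<bar>x \<bullet> e - \<mu>\<bar> \<le> \<gamma> \<and> A \<le> (norm x)\<^sup>2 \<and> (norm x)\<^sup>2 \<le> B \<and> c \<le> x \<bullet> v}" for v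
  define V where "V = shell_slab e \<mu> \<gamma> A B (DIM('a) * c\<^sup>2)"
  have nk: "norm x \<le> k" if "(norm x)\<^sup>2 \<le> B" for x :: 'a
    using power2_le_imp_le[OF order_trans[OF that assms(5)]] assms(6) by simp
  have lm: "W v \<in> lmeasurable" for v
  proof (rule lmeasurable_compact)
    have "closed (W v)"
      unfolding W_def by (intro closed_Collect_conj closed_Collect_le continuous_intros)
    moreover have "bounded (W v)" using nk by (auto simp: W_def bounded_iff)
    ultimately show "compact (W v)" by (simp add: compact_eq_bounded_closed)
  qed
  have piece: "measure lebesgue (W v) \<le> (B - A) / (2 * c) * measure lebesgue D"
    if v: "v \<bullet> e = 0" "norm v \<le> 1" for v
  proof (rule measure_le_thickness[where b = v])
    fix x assume x: "x \<in> W v"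
    show "x + t *\<^sub>R v \<in> D" if "0 \<le> t" "t \<le> 1" for t
    proof -
      have "t * norm v \<le> 1 * 1" using that v by (intro mult_mono) auto
      then have "norm (x + t *\<^sub>R v) \<le> k + 1"
        using norm_triangle_ineq[of x "t *\<^sub>R v"] nk[of x] x that by (simp add: W_def)
      then show ?thesis using x v by (simp add: W_def D_def inner_simps)
    qed
    show "x + h *\<^sub>R v \<notin> W v" if h: "(B - A) / (2 * c) < h" for h
    proof
      assume y: "x + h *\<^sub>R v \<in> W v"
      have "0 \<le> (B - A) / (2 * c)" using assms by simp
      then have "0 < h" using h by linarith
      \<comment> \<open>A shift by \<open>h\<close> raises the squared norm by at least
        \<open>2 * c * h\<close>, which cannot exceed \<open>B - A\<close> inside the shell.\<close>
      have "B - A < h * (2 * c)" using h \<open>0 < c\<close> by (simp add: pos_divide_less_eq)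
      also have "\<dots> \<le> h * (2 * (x \<bullet> v))" using x \<open>0 < h\<close> by (simp add: W_def)
      also have "\<dots> \<le> (norm (x + h *\<^sub>R v))\<^sup>2 - (norm x)\<^sup>2"
        unfolding power2_norm_eq_inner
        using \<open>0 < h\<close> by (simp add: inner_add_left inner_add_right inner_commute[of v x] algebra_simps)
      also have "\<dots> \<le> B - A" using x y by (simp add: W_def)
      finally show False by simp
    qed
  qed (use lm slab_lmeasurable assms in \<open>auto simp: D_def\<close>)
  have nb: "b i \<bullet> e = 0" "norm (b i) \<le> 1" if "i \<in> Basis" for i
  proof -
    show "b i \<bullet> e = 0" using ee by (simp add: b_def inner_simps)
    have "(norm (b i))\<^sup>2 = 1 - (i \<bullet> e)\<^sup>2"
      unfolding power2_norm_eq_inner b_def using ee that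
      by (simp add: inner_simps inner_commute[of e i] power2_eq_square)
    then have "(norm (b i))\<^sup>2 \<le> 1\<^sup>2" by simp
    then show "norm (b i) \<le> 1" by (rule power2_le_imp_le) simp
  qed
  have cover: "V \<subseteq> (\<Union>i\<in>Basis. W (b i) \<union> W (- b i))"
  proof
    fix x assume x: "x \<in> V"
    define x' where "x' = x - (x \<bullet> e) *\<^sub>R e"
    have xb: "x' \<bullet> i = x \<bullet> b i" for i by (simp add: x'_def b_def inner_simps inner_commute mult.commute)
    have "(norm x)\<^sup>2 - (x \<bullet> e)\<^sup>2 = x' \<bullet> x'"
      unfolding x'_def power2_norm_eq_inner using ee
      by (simp add: inner_simps inner_commute[of e x] power2_eq_square)
    also have "\<dots> = (\<Sum>i\<in>Basis. (x \<bullet> b i)\<^sup>2)"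
      by (subst euclidean_inner) (simp add: xb power2_eq_square)
    finally have le: "(\<Sum>i\<in>(Basis::'a set). c\<^sup>2) \<le> (\<Sum>i\<in>Basis. (x \<bullet> b i)\<^sup>2)"
      using x by (simp add: V_def shell_slab_def)
    \<comment> \<open>Pigeonhole: some summand reaches the average, and its sign selects
      \<open>b i\<close> or \<open>- b i\<close>.\<close>
    have "\<exists>i\<in>Basis. c\<^sup>2 \<le> (x \<bullet> b i)\<^sup>2"
    proof (rule ccontr)
      assume "\<not> ?thesis"
      then have "(\<Sum>i\<in>Basis. (x \<bullet> b i)\<^sup>2) < (\<Sum>i\<in>(Basis::'a set). c\<^sup>2)"
        by (intro sum_strict_mono) auto
      with le show False by simp
    qed
    then obtain i where i: "i \<in> Basis" "c\<^sup>2 \<le> (x \<bullet> b i)\<^sup>2" by blast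
    then have "c \<le> \<bar>x \<bullet> b i\<bar>" using \<open>0 < c\<close> by (simp add: abs_le_square_iff[symmetric])
    then have "x \<in> W (b i) \<or> x \<in> W (- b i)" using x by (auto simp: V_def shell_slab_def W_def abs_if split: if_splits)
    then show "x \<in> (\<Union>i\<in>Basis. W (b i) \<union> W (- b i))" using i by blast
  qed
  have "V \<in> lmeasurable" unfolding V_def by (rule shell_slab_lmeasurable)
  then have "measure lebesgue V \<le> measure lebesgue (\<Union>i\<in>Basis. W (b i) \<union> W (- b i))"
    using cover lm by (intro measure_mono_fmeasurable fmeasurable.finite_UN fmeasurable.Un) (auto dest: fmeasurableD)
  also have "\<dots> \<le> (\<Sum>i\<in>Basis. measure lebesgue (W (b i) \<union> W (- b i)))"
    using lm by (intro measure_UNION_le) (auto intro!: fmeasurableD)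
  also have "\<dots> \<le> (\<Sum>i\<in>(Basis::'a set). (B - A) / c * measure lebesgue D)"
  proof (rule sum_mono)
    fix i :: 'a assume i: "i \<in> Basis"
    have "measure lebesgue (W (b i) \<union> W (- b i)) \<le> measure lebesgue (W (b i)) + measure lebesgue (W (- b i))"
      using lm by (intro measure_Un_le fmeasurableD)
    also have "\<dots> \<le> (B - A) / (2 * c) * measure lebesgue D + (B - A) / (2 * c) * measure lebesgue D"
      using nb[OF i] by (intro add_mono piece) auto
    also have "\<dots> = (B - A) / c * measure lebesgue D" by (simp add: field_simps)
    finally show "measure lebesgue (W (b i) \<union> W (- b i)) \<le> (B - A) / c * measure lebesgue D" .
  qed
  also have "\<dots> = DIM('a) * ((B - A) / c * measure lebesgue D)" by simp
  also have "\<dots> \<le> DIM('a) * ((B - A) / c * (2 * \<gamma> * measure lebesgue (cball (0 :: 'a) (k + 2))))"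
  proof (intro mult_left_mono)
    show "measure lebesgue D \<le> 2 * \<gamma> * measure lebesgue (cball (0 :: 'a) (k + 2))"
      using slab_measure[OF assms(1,2), of "k + 1" \<mu>] by (simp add: D_def add.assoc)
  qed (use assms in auto)
  finally show ?thesis by (simp add: V_def)
qed

section \<open>The symmetric difference and the final estimate\<close>

text \<open>One of \<open>x\<close> and its mirror image \<open>y\<close> lies in \<Omega> and the
  other does not. Bounds known for \<open>y\<close> pass to \<open>x\<close> at a cost of at most
  \<bar>\<mu>\<bar> in the squared norm.\<close>

lemma sym_diff_reflection_subset:
  fixes e :: "'a::euclidean_space"
  assumes sub: "ball 0 r \<subseteq> \<Omega>" "\<Omega> \<subseteq> ball 0 R" and r: "1/2 \<le> r" and e: "norm e = 1"
    and \<mu>: "\<bar>\<mu>\<bar> \<le> 1/8" and \<gamma>: "\<gamma> \<le> 1/4"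
  shows "{x \<in> sym_diff \<Omega> (reflection e \<mu> ` \<Omega>). \<bar>x \<bullet> e - \<mu>\<bar> \<le> \<gamma>}
    \<subseteq> shell_slab e \<mu> \<gamma> (r\<^sup>2 - \<bar>\<mu>\<bar>) (R\<^sup>2 + \<bar>\<mu>\<bar>) (1/16)"
proof
  fix x assume "x \<in> {x \<in> sym_diff \<Omega> (reflection e \<mu> ` \<Omega>). \<bar>x \<bullet> e - \<mu>\<bar> \<le> \<gamma>}"
  then have x: "(x \<in> \<Omega>) \<noteq> (reflection e \<mu> x \<in> \<Omega>)" and s: "\<bar>x \<bullet> e - \<mu>\<bar> \<le> \<gamma>"
    using mem_reflection_image[OF e] by blast+
  define y where "y = reflection e \<mu> x"
  have diff: "(norm x)\<^sup>2 - (norm y)\<^sup>2 = 4 * \<mu> * (x \<bullet> e - \<mu>)"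
    unfolding y_def by (rule inner_reflection_diff[OF e])
  have ye: "y \<bullet> e = 2 * \<mu> - x \<bullet> e"
    using e by (simp add: y_def reflection_def inner_simps norm_eq_1)
  \<comment> \<open>Reflection preserves the component orthogonal to \<open>e\<close>, so it can be
    estimated at the point outside \<Omega>: its square is at least 1/4 - 9/64, which exceeds
    1/16.\<close>
  then have tang: "(norm y)\<^sup>2 - (y \<bullet> e)\<^sup>2 = (norm x)\<^sup>2 - (x \<bullet> e)\<^sup>2"
    using diff unfolding ye by (simp add: power2_eq_square algebra_simps)
  have "\<bar>x \<bullet> e\<bar> \<le> 3/8" "\<bar>y \<bullet> e\<bar> \<le> 3/8" using s \<gamma> \<mu> ye by linarith+
  then have sq: "(x \<bullet> e)\<^sup>2 \<le> 9/64" "(y \<bullet> e)\<^sup>2 \<le> 9/64"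
    using abs_le_square_iff[of "x \<bullet> e" "3/8"] abs_le_square_iff[of "y \<bullet> e" "3/8"]
    by (simp_all add: power2_eq_square)
  have "\<bar>\<mu>\<bar> * \<bar>x \<bullet> e - \<mu>\<bar> \<le> \<bar>\<mu>\<bar> * (1/4)" using s \<gamma> by (intro mult_left_mono) auto
  then have d: "\<bar>(norm x)\<^sup>2 - (norm y)\<^sup>2\<bar> \<le> \<bar>\<mu>\<bar>" unfolding diff by (simp add: abs_mult)
  have "(1/2)\<^sup>2 \<le> r\<^sup>2" using r by (intro power_mono) auto
  then have r4: "1/4 \<le> r\<^sup>2" by (simp add: power2_eq_square)
  have out: "r\<^sup>2 \<le> (norm z)\<^sup>2" if "z \<notin> \<Omega>" for z
  proof -
    have "r \<le> norm z" using sub(1) that by (metis linorder_not_less mem_ball_0 subsetD)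
    then show ?thesis using r by (intro power_mono) auto
  qed
  have inside: "(norm z)\<^sup>2 \<le> R\<^sup>2" if "z \<in> \<Omega>" for z
  proof -
    have "norm z < R" using sub(2) that by auto
    then show ?thesis by (intro power_mono) auto
  qed
  consider "x \<in> \<Omega>" "y \<notin> \<Omega>" | "x \<notin> \<Omega>" "y \<in> \<Omega>" using x unfolding y_def by blast
  then have "r\<^sup>2 - \<bar>\<mu>\<bar> \<le> (norm x)\<^sup>2 \<and> (norm x)\<^sup>2 \<le> R\<^sup>2 + \<bar>\<mu>\<bar> \<and> 1/16 \<le> (norm x)\<^sup>2 - (x \<bullet> e)\<^sup>2"
  proof cases
    case 1
    then show ?thesis using inside[of x] out[of y] d sq tang r4 by linarith
  next
    case 2
    then show ?thesis using inside[of y] out[of x] d sq tang r4 by linarith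
  qed
  then show "x \<in> shell_slab e \<mu> \<gamma> (r\<^sup>2 - \<bar>\<mu>\<bar>) (R\<^sup>2 + \<bar>\<mu>\<bar>) (1/16)"
    using s by (simp add: shell_slab_def)
qed

theorem theorem6p3:
  fixes \<alpha> M \<rho> :: real
  assumes "\<alpha> > 1" and "M > 0" and "\<rho> \<in> {0<..<1/4}"
  shows "\<exists>C>0. \<forall>(\<Omega> :: (real ^ 'n) set) r R e.
    open \<Omega> \<and> bounded \<Omega> \<and> boundary_class \<alpha> M \<rho> \<Omega> \<and>
    ball 0 r \<subseteq> \<Omega> \<and> \<Omega> \<subseteq> ball 0 R \<and> 1/2 \<le> r \<and> r \<le> R \<and> R \<le> 2 \<and>
    norm e = 1 \<and> infdist 0 (hyperplane_at e (critical_value \<Omega> e)) \<le> 1/8 \<longrightarrow>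
    (\<forall>\<gamma>. 0 < \<gamma> \<and> \<gamma> \<le> 1/4 \<longrightarrow>
      measure lebesgue
        {x \<in> sym_diff \<Omega> (reflection e (critical_value \<Omega> e) ` \<Omega>).
           infdist x (hyperplane_at e (critical_value \<Omega> e)) \<le> \<gamma>}
      \<le> C * \<gamma> * (R - r) powr (1 - 1 / \<alpha>))"
proof -
  obtain K where "K > 0" and K: "\<And>(\<Omega> :: (real ^ 'n) set) r R e.
      boundary_class \<alpha> M \<rho> \<Omega> \<Longrightarrow> ball 0 r \<subseteq> \<Omega> \<Longrightarrow> \<Omega> \<subseteq> ball 0 R \<Longrightarrow> 0 < r \<Longrightarrow> r \<le> R \<Longrightarrow> R \<le> 2 \<Longrightarrow>
      norm e = 1 \<Longrightarrow> \<bar>critical_value \<Omega> e\<bar> \<le> 1 \<Longrightarrow>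
      \<bar>critical_value \<Omega> e\<bar> \<le> K * (R - r) powr (1 - 1/\<alpha>)"
    using critical_value_abs_bound[of \<alpha> M \<rho>, where 'a = "real ^ 'n"] assms by auto
  define n where "n = real DIM(real ^ 'n)"
  \<comment> \<open>Chosen so that \<open>n * c\<^sup>2\<close> equals the bound 1/16 on the
    orthogonal component.\<close>
  define c where "c = sqrt (1 / (16 * n))"
  have "n > 0" by (simp add: n_def)
  then have c: "0 < c" "n * c\<^sup>2 = 1/16" by (simp_all add: c_def)
  define V where "V = measure lebesgue (cball (0 :: real ^ 'n) 5)"
  have "V \<ge> 0" by (simp add: V_def)
  \<comment> \<open>\<open>8 + 2 * K\<close> bounds \<open>(B - A) / \<eta>\<close> when \<eta> > 0:
    \<open>R\<^sup>2 - r\<^sup>2\<close> gives 8 and \<open>2 * \<bar>\<mu>\<bar>\<close> gives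
    \<open>2 * K\<close>. The radius 5 in \<open>V\<close> is \<open>k + 2\<close> with
    \<open>k = 3\<close>, and the added 1 makes \<open>C\<close> positive.\<close>
  define C where "C = n * ((8 + 2 * K) / c * (2 * V)) + 1"
  have "measure lebesgue {x \<in> sym_diff \<Omega> (reflection e \<mu> ` \<Omega>). infdist x (hyperplane_at e \<mu>) \<le> \<gamma>}
      \<le> C * \<gamma> * (R - r) powr (1 - 1 / \<alpha>)"
    if "open \<Omega>" and bc: "boundary_class \<alpha> M \<rho> \<Omega>" and sub: "ball 0 r \<subseteq> \<Omega>" "\<Omega> \<subseteq> ball 0 R"
      and rR: "1/2 \<le> r" "r \<le> R" "R \<le> 2" and e: "norm e = 1" and \<mu>: "\<mu> = critical_value \<Omega> e"
      and inf: "infdist 0 (hyperplane_at e \<mu>) \<le> 1/8" and \<gamma>: "0 < \<gamma>" "\<gamma> \<le> 1/4"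
    for \<Omega> :: "(real ^ 'n) set" and r R e \<mu> \<gamma>
  proof -
    define \<eta> where "\<eta> = (R - r) powr (1 - 1/\<alpha>)"
    define E where "E = {x \<in> sym_diff \<Omega> (reflection e \<mu> ` \<Omega>). \<bar>x \<bullet> e - \<mu>\<bar> \<le> \<gamma>}"
    define A B where "A = r\<^sup>2 - \<bar>\<mu>\<bar>" and "B = R\<^sup>2 + \<bar>\<mu>\<bar>"
    have l8: "\<bar>\<mu>\<bar> \<le> 1/8" using inf infdist_hyperplane_at[OF e, of 0 \<mu>] by simp
    have l: "\<bar>\<mu>\<bar> \<le> K * \<eta>" using K[OF bc sub _ rR(2,3) e] rR l8 unfolding \<mu> \<eta>_def by simp
    have gap: "R - r \<le> 2 * \<eta>"
      unfolding \<eta>_def using assms(1) rR by (intro powr_interpolation_gap) auto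
    have "(R - r) * (R + r) \<le> (R - r) * 4" using rR by (intro mult_left_mono) auto
    then have AB: "A \<le> B" "B - A \<le> (8 + 2 * K) * \<eta>"
      using l gap power_mono[of r R 2] rR
      by (simp_all add: A_def B_def power2_eq_square algebra_simps)
    have "R\<^sup>2 \<le> 2\<^sup>2" using rR by (intro power_mono) auto
    then have B: "B \<le> 3\<^sup>2" using l8 by (simp add: B_def)
    \<comment> \<open>As an involution, the reflection turns images into preimages, so the reflected
      set is open and \<open>E\<close> is measurable.\<close>
    have "reflection e \<mu> ` \<Omega> = reflection e \<mu> -` \<Omega>"
      using mem_reflection_image[OF e] by blast
    moreover have "open (reflection e \<mu> -` \<Omega>)"
      using \<open>open \<Omega>\<close> by (rule open_vimage) (auto simp: reflection_def intro!: continuous_intros)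
    moreover have "closed {x. \<bar>x \<bullet> e - \<mu>\<bar> \<le> \<gamma>}" by (intro closed_Collect_le continuous_intros)
    moreover have "E = sym_diff \<Omega> (reflection e \<mu> ` \<Omega>) \<inter> {x. \<bar>x \<bullet> e - \<mu>\<bar> \<le> \<gamma>}" by (auto simp: E_def)
    ultimately have "E \<in> sets lebesgue"
      using \<open>open \<Omega>\<close> by (auto intro!: sets.Int sets.Un sets.Diff borel_closed borel_open sets_completionI_sets)
    moreover have "E \<subseteq> shell_slab e \<mu> \<gamma> A B (1/16)"
      unfolding E_def A_def B_def by (rule sym_diff_reflection_subset[OF sub rR(1) e l8 \<gamma>(2)])
    ultimately have "measure lebesgue E \<le> measure lebesgue (shell_slab e \<mu> \<gamma> A B (1/16))"
      using shell_slab_lmeasurable by (intro measure_mono_fmeasurable)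
    also have "\<dots> \<le> n * ((B - A) / c * (2 * \<gamma> * V))"
      using shell_slab_measure[OF e \<gamma>(1) c(1) AB(1) B, of \<mu>, folded n_def]
      unfolding c(2) V_def by simp
    also have "\<dots> \<le> n * ((8 + 2 * K) * \<eta> / c * (2 * \<gamma> * V))"
      using AB(2) c \<open>n > 0\<close> \<gamma> \<open>V \<ge> 0\<close>
      by (intro mult_left_mono mult_right_mono divide_right_mono) auto
    also have "\<dots> \<le> C * \<gamma> * \<eta>" using \<gamma> by (simp add: C_def algebra_simps \<eta>_def)
    finally show ?thesis by (simp add: E_def \<eta>_def infdist_hyperplane_at[OF e])
  qed
  moreover have "C > 0"
    using \<open>K > 0\<close> c \<open>n > 0\<close> \<open>V \<ge> 0\<close> by (simp add: C_def add_nonneg_pos)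
  ultimately show ?thesis by blast
qed

end
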